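(* Every minimal Cantor system of finite topological rank is strongly orbit equivalent to a subshift $(Y,S)$ of sub-linear complexity, i.e. such that $\limsup_{n\to+\infty}p_Y(n)/n<+\infty$.
   Context: A minimal Cantor system $(X,T)$ is a homeomorphism $T$ of a Cantor set $X$ all of whose orbits are dense. $S$ is the shift map and $p_Y(n)$ is the number of words of length $n$ occurring in elements of $Y$. Strong orbit equivalence: minimal Cantor systems $(X,T)$ and $(Y,R)$ are strongly orbit equivalent if there is a homeomorphism $\phi:X\to Y$ sending $T$-orbits onto $R$-orbits such that the (uniquely defined) maps $\alpha,\beta:X\to\mathbb Z$ with $\phi(Tx)=R^{\alpha(x)}\phi(x)$ and $\phi(T^{\beta(x)}x)=R\phi(x)$ each have at most one point of discontinuity. Topological rank. A clopen Kakutani-Rohlin (CKR) partition of $X$ is a partition $\mathcal T=\{T^{-j}B(k):1\le k\le d,\ 0\le j<h(k)\}$ of $X$, where $B(1),\dots,B(d)$ are clopen, $h(k)\geq 1$ and $\bigcup_k T^{-h(k)}B(k)=\bigcup_k B(k)$; its base is $B(\mathcal T)=\bigcup_k B(k)$, and it has $d$ towers $\mathcal T(k)=\{T^{-j}B(k):0\le j<h(k)\}$. A sequence $(\mathcal T_n)_{n\ge0}$ of CKR partitions, $\mathcal T_n=\{T^{-j}B_n(k):1\le k\le d_n,0\le j<h_n(k)\}$, $\mathcal T_0=\{X\}$, is nested if for all $n$: $B(\mathcal T_{n+1})\subseteq B(\mathcal T_n)$; $\mathcal T_{n+1}$ refines $\mathcal T_n$; $\bigcap_n B(\mathcal T_n)$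 is a single point; and the partitions $\mathcal T_n$ span the topology of $X$. It is primitive if for every $n\ge1$ there is $N>n$ such that every tower of $\mathcal T_N$ crosses every tower of $\mathcal T_n$ (i.e. the points of each $T^{-(h_N(k)-1)}B_N(k)$, iterated by $T$ until reaching $B_N(k)$, completely cross all towers of $\mathcal T_n$). The system has finite topological rank if it admits a primitive nested sequence of CKR partitions with $d_n\le d$ for all $n$, for some $d$ (equivalently, a Bratteli-Vershik representation with at most $d$ vertices per level). *)

theory Defs
  imports "HOL-Analysis.Analysis"
begin

definition cantor_set :: "'a topology \<Rightarrow> bool" where
  "cantor_set X \<longleftrightarrow>
     X homeomorphic_space product_topology (\<lambda>_::nat. discrete_topology (UNIV::bool set)) UNIV"

text \<open>The integer iterate \<open>T\<^sup>n\<close> on the points of \<open>X\<close>; the values of \<open>T\<close> outside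
  \<open>topspace X\<close> play no role.\<close>

definition int_iter :: "'a topology \<Rightarrow> ('a \<Rightarrow> 'a) \<Rightarrow> int \<Rightarrow> 'a \<Rightarrow> 'a" where
  "int_iter X T n =
     (if 0 \<le> n then T ^^ nat n else (inv_into (topspace X) T) ^^ nat (- n))"

definition orbit_of :: "'a topology \<Rightarrow> ('a \<Rightarrow> 'a) \<Rightarrow> 'a \<Rightarrow> 'a set" where
  "orbit_of X T x = range (\<lambda>n. int_iter X T n x)"

definition minimal_cantor_system :: "'a topology \<Rightarrow> ('a \<Rightarrow> 'a) \<Rightarrow> bool" where
  "minimal_cantor_system X T \<longleftrightarrow>
     cantor_set X \<and> homeomorphic_map X X T \<and>
     (\<forall>x\<in>topspace X. X closure_of (orbit_of X T x) = topspace X)"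

definition at_most_one_discontinuity :: "'a topology \<Rightarrow> ('a \<Rightarrow> int) \<Rightarrow> bool" where
  "at_most_one_discontinuity X f \<longleftrightarrow>
     (\<exists>p. {x \<in> topspace X. \<not> topcontinuous_at X (discrete_topology UNIV) f x} \<subseteq> {p})"

text \<open>The cocycles \<open>\<alpha>\<close> and \<open>\<beta>\<close> are quantified existentially: minimality on an infinite space
  makes \<open>T\<close> and \<open>R\<close> aperiodic, so they are determined by \<open>\<phi>\<close> on \<open>topspace X\<close>.\<close>

definition strongly_orbit_equivalent ::
    "'a topology \<Rightarrow> ('a \<Rightarrow> 'a) \<Rightarrow> 'b topology \<Rightarrow> ('b \<Rightarrow> 'b) \<Rightarrow> bool" where
  "strongly_orbit_equivalent X T Y R \<longleftrightarrow>
     (\<exists>\<phi>. homeomorphic_map X Y \<phi> \<and>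
          (\<forall>x\<in>topspace X. \<phi> ` orbit_of X T x = orbit_of Y R (\<phi> x)) \<and>
          (\<exists>\<alpha> \<beta>. (\<forall>x\<in>topspace X. \<phi> (T x) = int_iter Y R (\<alpha> x) (\<phi> x)) \<and>
                 (\<forall>x\<in>topspace X. \<phi> (int_iter X T (\<beta> x) x) = R (\<phi> x)) \<and>
                 at_most_one_discontinuity X \<alpha> \<and> at_most_one_discontinuity X \<beta>))"

text \<open>\<open>preim X T j B\<close> is \<open>T\<^sup>-\<^sup>j B\<close>.\<close>

definition preim :: "'a topology \<Rightarrow> ('a \<Rightarrow> 'a) \<Rightarrow> nat \<Rightarrow> 'a set \<Rightarrow> 'a set" where
  "preim X T j B = {x \<in> topspace X. (T ^^ j) x \<in> B}"

text \<open>A clopen Kakutani-Rohlin partition is given by its number \<open>d\<close> of towers, its bases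
  \<open>B 1, \<dots>, B d\<close> and its heights \<open>h 1, \<dots>, h d\<close>; values of \<open>B\<close> and \<open>h\<close> at other
  indices are irrelevant.\<close>

definition ckr_atoms ::
    "'a topology \<Rightarrow> ('a \<Rightarrow> 'a) \<Rightarrow> nat \<Rightarrow> (nat \<Rightarrow> 'a set) \<Rightarrow> (nat \<Rightarrow> nat) \<Rightarrow> 'a set set" where
  "ckr_atoms X T d B h = {preim X T j (B k) | k j. k \<in> {1..d} \<and> j < h k}"

definition ckr_base :: "nat \<Rightarrow> (nat \<Rightarrow> 'a set) \<Rightarrow> 'a set" where
  "ckr_base d B = (\<Union>k\<in>{1..d}. B k)"

text \<open>Besides \<open>partition_on\<close>, which concerns the set of atoms, disjointness is required of the
  indexed family, so that distinct pairs \<open>(k, j)\<close> give distinct atoms.\<close>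

definition ckr_partition ::
    "'a topology \<Rightarrow> ('a \<Rightarrow> 'a) \<Rightarrow> nat \<Rightarrow> (nat \<Rightarrow> 'a set) \<Rightarrow> (nat \<Rightarrow> nat) \<Rightarrow> bool" where
  "ckr_partition X T d B h \<longleftrightarrow>
     (\<forall>k\<in>{1..d}. openin X (B k) \<and> closedin X (B k) \<and> 1 \<le> h k) \<and>
     partition_on (topspace X) (ckr_atoms X T d B h) \<and>
     disjoint_family_on (\<lambda>(k, j). preim X T j (B k)) (SIGMA k:{1..d}. {..<h k}) \<and>
     (\<Union>k\<in>{1..d}. preim X T (h k) (B k)) = ckr_base d B"

definition nested_ckr ::
    "'a topology \<Rightarrow> ('a \<Rightarrow> 'a) \<Rightarrow> (nat \<Rightarrow> nat) \<Rightarrow> (nat \<Rightarrow> nat \<Rightarrow> 'a set) \<Rightarrow>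
     (nat \<Rightarrow> nat \<Rightarrow> nat) \<Rightarrow> bool" where
  "nested_ckr X T d B h \<longleftrightarrow>
     (\<forall>n. ckr_partition X T (d n) (B n) (h n)) \<and>
     ckr_atoms X T (d 0) (B 0) (h 0) = {topspace X} \<and>
     (\<forall>n. ckr_base (d (Suc n)) (B (Suc n)) \<subseteq> ckr_base (d n) (B n)) \<and>
     (\<forall>n. refines (topspace X) (ckr_atoms X T (d (Suc n)) (B (Suc n)) (h (Suc n)))
                               (ckr_atoms X T (d n) (B n) (h n))) \<and>
     (\<exists>x. (\<Inter>n. ckr_base (d n) (B n)) = {x}) \<and>
     topology_generated_by (\<Union>n. ckr_atoms X T (d n) (B n) (h n)) = X"

text \<open>A tower \<open>(B, h)\<close> crosses a tower \<open>(B', h')\<close>: every point of its lowest floor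
  \<open>T\<^sup>-\<^sup>(\<^sup>h\<^sup>-\<^sup>1\<^sup>) B\<close>, followed up to \<open>B\<close>, at some time \<open>i\<close> enters the lowest floor of the other
  tower and climbs it up to \<open>B'\<close> by time \<open>h - 1\<close>.\<close>

definition crosses ::
    "'a topology \<Rightarrow> ('a \<Rightarrow> 'a) \<Rightarrow> 'a set \<Rightarrow> nat \<Rightarrow> 'a set \<Rightarrow> nat \<Rightarrow> bool" where
  "crosses X T B h B' h' \<longleftrightarrow>
     (\<forall>x\<in>preim X T (h - 1) B. \<exists>i. i + h' \<le> h \<and>
        (\<forall>j<h'. (T ^^ (i + j)) x \<in> preim X T (h' - 1 - j) B'))"

definition primitive_ckr ::
    "'a topology \<Rightarrow> ('a \<Rightarrow> 'a) \<Rightarrow> (nat \<Rightarrow> nat) \<Rightarrow> (nat \<Rightarrow> nat \<Rightarrow> 'a set) \<Rightarrow>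
     (nat \<Rightarrow> nat \<Rightarrow> nat) \<Rightarrow> bool" where
  "primitive_ckr X T d B h \<longleftrightarrow>
     (\<forall>n\<ge>1. \<exists>N>n. \<forall>k\<in>{1..d N}. \<forall>l\<in>{1..d n}.
        crosses X T (B N k) (h N k) (B n l) (h n l))"

definition finite_topological_rank :: "'a topology \<Rightarrow> ('a \<Rightarrow> 'a) \<Rightarrow> bool" where
  "finite_topological_rank X T \<longleftrightarrow>
     (\<exists>d B h. nested_ckr X T d B h \<and> primitive_ckr X T d B h \<and> (\<exists>D. \<forall>n. d n \<le> D))"

definition shift :: "(int \<Rightarrow> 'b) \<Rightarrow> int \<Rightarrow> 'b" where
  "shift y = (\<lambda>i. y (i + 1))"

definition full_shift :: "'b set \<Rightarrow> (int \<Rightarrow> 'b) topology" where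
  "full_shift A = product_topology (\<lambda>_. discrete_topology A) UNIV"

definition is_subshift :: "'b set \<Rightarrow> (int \<Rightarrow> 'b) set \<Rightarrow> bool" where
  "is_subshift A Y \<longleftrightarrow> finite A \<and> closedin (full_shift A) Y \<and> shift ` Y = Y"

definition words :: "(int \<Rightarrow> 'b) set \<Rightarrow> nat \<Rightarrow> 'b list set" where
  "words Y n = {map (\<lambda>j. y (i + int j)) [0..<n] | y i. y \<in> Y}"

definition complexity :: "(int \<Rightarrow> 'b) set \<Rightarrow> nat \<Rightarrow> nat" where
  "complexity Y n = card (words Y n)"

end

theory Submission
  imports Defs
begin

text \<open>
After telescoping, the first block of every tower of level \<open>n + 1\<close> is the same tower \<open>a n\<close> of level
\<open>n\<close>, and every tower of level \<open>n\<close> occurs many times in every tower of level \<open>n + 1\<close>. Split the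
tower \<open>a n\<close> into three copies: its occurrences as a first block (tag 1), its occurrences as the
second block of this kind (tag 2), and the others (tag 0). Then reorder the blocks in each tower of
level \<open>n + 1\<close> without moving the first and the last one: first the block of tag 1, then a number of
copies of \<open>a n\<close> that identifies the tower, then the block of tag 2, and then the remaining blocks
grouped by letter.

Climbing the towers in the new order defines a homeomorphism \<open>R\<close> of the same space. Because the
first and last blocks are kept, \<open>R\<close> agrees with \<open>T\<close> at the single point \<open>x0\<close> that is on top of its
tower at all levels, so \<open>R\<close> has the orbits of \<open>T\<close> and both cocycles are locally constant off \<open>x0\<close>.
The itinerary of a point under \<open>R\<close> through the floors of level 0 determines its position at all
levels by recursion on the level, since tag 1 marks the beginning of a tower and the time of the next
visit to tag 2 names the tower. Hence \<open>R\<close> is conjugate to a subshift. Its complexity is linear because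
the word of a tower is a concatenation of boundedly many powers of words of the previous level, and
a power \<open>v\<^sup>m\<close> has at most \<open>N\<close> more factors of length \<open>N\<close> than \<open>v\<close>.
\<close>

section \<open>Factors of words and reordering of blocks\<close>

text \<open>The number of blocks in a tower of level n + 1 need not be bounded, so the given order
  offers no control of the factors of its word. Grouping equal blocks leaves at most
  \<open>D + 6\<close> runs at every level, but grouping alone could make the higher levels
  invisible in the coding. The marks repair this. The name \<open>c\<close> of a tower of level n +
  1 consists of its index and of the tag that it carries inside level n + 2, and the run of
  \<open>a n\<close> before the marked block spells this whole name as the number
  \<open>enc c\<close>. Copies of one tower with different tags are thus ordered differently, and
  the name recovered at level n + 1 contains the tag from which the recovery of level n + 2 starts.
  As \<open>enc c\<close> is at most \<open>3 * D + 2\<close>, and three occurrences of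
  \<open>a n\<close> may be taken up by the first, the marked and the last block,
  \<open>3 * D + 10\<close> occurrences are enough. The bound on factors grows at every level, so it
  is propagated only through two levels, chosen according to the length \<open>N\<close>.\<close>

definition block_factors :: "nat \<Rightarrow> 'b list \<Rightarrow> 'b list set" where
  "block_factors N u = {take N (drop i u) | i. i + N \<le> length u}"

lemma block_factors_alt: "block_factors N u = (\<lambda>i. take N (drop i u)) ` {i. i + N \<le> length u}"
  by (auto simp: block_factors_def)

lemma finite_block_factors [simp]: "finite (block_factors N u)"
  unfolding block_factors_alt by (rule finite_imageI, rule finite_subset[of _ "{..length u}"]) auto

lemma card_block_factors_le_length:
  assumes "1 \<le> N" shows "card (block_factors N u) \<le> length u"
proof -
  have "card (block_factors N u) \<le> card {i. i + N \<le> length u}"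
    unfolding block_factors_alt by (rule card_image_le) (rule finite_subset[of _ "{..length u}"], auto)
  also have "\<dots> \<le> card {..<length u}"
    using assms by (intro card_mono) auto
  finally show ?thesis by simp
qed

lemma card_block_factors_short:
  assumes "length u \<le> N" shows "card (block_factors N u) \<le> 1"
proof -
  have "block_factors N u \<subseteq> {take N u}"
  proof
    fix x assume "x \<in> block_factors N u"
    then obtain i where "i + N \<le> length u" "x = take N (drop i u)" by (auto simp: block_factors_def)
    moreover from this assms have "i = 0 \<or> N = 0" by linarith
    ultimately show "x \<in> {take N u}" by auto
  qed
  then show ?thesis using card_mono[of "{take N u}"] by simp
qed

lemma card_block_factors_append:
  "card (block_factors N (u @ v)) \<le> card (block_factors N u) + card (block_factors N v) + N"
proof -
  \<comment> \<open>The windows across the seam, indexed by the number of letters taken from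
    \<open>u\<close>; when \<open>i\<close> exceeds \<open>length u\<close>, truncation gives the
    window at position 0.\<close>
  let ?C = "(\<lambda>i. take N (drop (length u - i) (u @ v))) ` {1..<N}"
  have "block_factors N (u @ v) \<subseteq> block_factors N u \<union> block_factors N v \<union> ?C"
  proof
    fix x assume "x \<in> block_factors N (u @ v)"
    then obtain i where i: "i + N \<le> length u + length v" "x = take N (drop i (u @ v))"
      by (auto simp: block_factors_def)
    consider "i + N \<le> length u" | "length u \<le> i" | "i < length u" "length u < i + N" by linarith
    then show "x \<in> block_factors N u \<union> block_factors N v \<union> ?C"
    proof cases
      case 1 then show ?thesis using i by (auto simp: block_factors_def)
    next
      case 2
      then have "x = take N (drop (i - length u) v)" using i by simp
      moreover have "i - length u + N \<le> length v" using i 2 by linarith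
      ultimately show ?thesis by (auto simp: block_factors_def)
    next
      case 3
      then have "x = take N (drop (length u - (length u - i)) (u @ v))" using i by simp
      moreover have "length u - i \<in> {1..<N}" using 3 by auto
      ultimately show ?thesis by blast
    qed
  qed
  then have "card (block_factors N (u @ v)) \<le> card (block_factors N u \<union> block_factors N v \<union> ?C)"
    by (intro card_mono) auto
  also have "\<dots> \<le> card (block_factors N u) + card (block_factors N v) + card ?C"
    by (meson add_mono card_Un_le le_trans order_refl)
  also have "card ?C \<le> N"
    by (metis card_atLeastLessThan card_image_le diff_le_self finite_atLeastLessThan le_trans)
  finally show ?thesis by simp
qed

lemma nth_concat_replicate:
  "i < m * length v \<Longrightarrow> concat (replicate m v) ! i = v ! (i mod length v)"
proof (induction m arbitrary: i)
  case (Suc m)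
  then have pos: "0 < length v" by (cases "length v") auto
  show ?case
  proof (cases "i < length v")
    case False
    then have "concat (replicate (Suc m) v) ! i = v ! ((i - length v) mod length v)"
      using Suc by (simp add: nth_append)
    then show ?thesis using False by (simp add: le_mod_geq)
  qed (simp add: nth_append)
qed simp

text \<open>A window of a power of \<open>v\<close> is determined by its position modulo the length of \<open>v\<close>, and
  at most \<open>N\<close> of these residues give a window that does not fit inside one copy of \<open>v\<close>.\<close>

lemma card_block_factors_replicate:
  "card (block_factors N (concat (replicate m v))) \<le> card (block_factors N v) + N"
proof -
  let ?w = "\<lambda>i. map (\<lambda>j. v ! ((i + j) mod length v)) [0..<N]"
  have len: "length (concat (replicate m v)) = m * length v" by (induction m) auto
  have mem: "\<exists>r<length v. x = ?w r"
    if x: "x \<in> block_factors N (concat (replicate m v))" and "0 < N" for x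
  proof -
    obtain i where i: "i + N \<le> m * length v" "x = take N (drop i (concat (replicate m v)))"
      using x unfolding block_factors_def len by blast
    have pos: "0 < length v" using i \<open>0 < N\<close> by (cases "length v") auto
    have "x = ?w (i mod length v)"
    proof (rule nth_equalityI)
      show "length x = length (?w (i mod length v))" using i len by simp
      fix j assume "j < length x"
      then have j: "j < N" using i by simp
      then have "x ! j = concat (replicate m v) ! (i + j)" using i len by simp
      also have "\<dots> = v ! ((i + j) mod length v)" by (rule nth_concat_replicate) (use i j in linarith)
      finally show "x ! j = ?w (i mod length v) ! j" using j by (simp add: mod_add_left_eq)
    qed
    then show ?thesis using pos by (intro exI[of _ "i mod length v"]) simp
  qed
  show ?thesis
  proof (cases "N = 0")
    case True
    then show ?thesis by (simp add: block_factors_def)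
        (metis (mono_tags, lifting) Collect_cong le0 order_refl singleton_conv)
  next
    case False
    let ?S = "{r. r < length v \<and> length v < r + N}"
    have "card ?S \<le> card {length v - N..<length v}" by (rule card_mono) auto
    then have cS: "card ?S \<le> N" by simp
    have sub: "block_factors N (concat (replicate m v)) \<subseteq> block_factors N v \<union> ?w ` ?S"
    proof
      fix x assume "x \<in> block_factors N (concat (replicate m v))"
      then obtain r where r: "r < length v" "x = ?w r" using mem False by auto
      show "x \<in> block_factors N v \<union> ?w ` ?S"
      proof (cases "r + N \<le> length v")
        case True
        then have "x = take N (drop r v)"
          using r by (intro nth_equalityI) auto
        then show ?thesis using True by (auto simp: block_factors_def)
      next
        case False
        then show ?thesis using r by auto
      qed
    qed
    have "card (block_factors N (concat (replicate m v))) \<le> card (block_factors N v \<union> ?w ` ?S)"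
      using sub by (intro card_mono) auto
    also have "\<dots> \<le> card (block_factors N v) + card (?w ` ?S)" by (rule card_Un_le)
    also have "card (?w ` ?S) \<le> N" using cS card_image_le[of ?S ?w] by fastforce
    finally show ?thesis by simp
  qed
qed

text \<open>A run costs \<open>F\<close> for the factors inside one copy of \<open>f v\<close>,
  \<open>N\<close> for the windows that leave a copy inside the power, and \<open>N\<close> for the
  seam with the next run. The exponent \<open>m\<close> does not enter.\<close>

lemma card_block_factors_runs:
  assumes "1 \<le> N" and "\<And>m v. (m, v) \<in> set rs \<Longrightarrow> card (block_factors N (f v)) \<le> F"
  shows "card (block_factors N (concat (map (\<lambda>(m, v). concat (replicate m (f v))) rs)))
           \<le> length rs * (F + 2 * N)"
  using assms(2)
proof (induction rs)
  case Nil
  then show ?case using assms(1) by (simp add: block_factors_def)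
next
  case (Cons r rs)
  obtain m v where r: "r = (m, v)" by fastforce
  let ?u = "concat (map (\<lambda>(m, v). concat (replicate m (f v))) rs)"
  have "card (block_factors N (concat (replicate m (f v)) @ ?u))
      \<le> card (block_factors N (concat (replicate m (f v)))) + card (block_factors N ?u) + N"
    by (rule card_block_factors_append)
  moreover have "card (block_factors N (concat (replicate m (f v)))) \<le> F + N"
    using card_block_factors_replicate[of N m "f v"] Cons.prems[of m v] r by simp
  moreover have "card (block_factors N ?u) \<le> length rs * (F + 2 * N)"
    by (rule Cons.IH) (use Cons.prems in auto)
  ultimately show ?case using r by simp
qed

section \<open>Words with a bounded number of runs\<close>

definition has_runs :: "nat \<Rightarrow> 'b list \<Rightarrow> bool" where
  "has_runs r xs \<longleftrightarrow>
     (\<exists>rs. length rs \<le> r \<and> xs = concat (map (\<lambda>(m, v). replicate m v) rs))"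

lemma has_runs_append: "has_runs r xs \<Longrightarrow> has_runs s ys \<Longrightarrow> has_runs (r + s) (xs @ ys)"
  unfolding has_runs_def by (metis add_mono concat_append length_append map_append)

lemma has_runs_constant: "set xs \<subseteq> {v} \<Longrightarrow> has_runs (Suc 0) xs"
  unfolding has_runs_def
  by (rule exI[of _ "[(length xs, v)]"]) (auto intro!: replicate_eqI)

lemma card_block_factors_has_runs:
  assumes "1 \<le> N" and "has_runs r xs" and "\<And>v. v \<in> set xs \<Longrightarrow> card (block_factors N (f v)) \<le> F"
  shows "card (block_factors N (concat (map f xs))) \<le> r * (F + 2 * N)"
proof -
  obtain rs where rs: "length rs \<le> r" "xs = concat (map (\<lambda>(m, v). replicate m v) rs)"
    using assms(2) by (auto simp: has_runs_def)
  \<comment> \<open>An empty run may carry a letter that does not occur in \<open>xs\<close>, for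
    which no bound is assumed.\<close>
  define rs' where "rs' = filter (\<lambda>(m, v). 0 < m) rs"
  have xs: "xs = concat (map (\<lambda>(m, v). replicate m v) rs')"
    unfolding rs(2) rs'_def by (induction rs) auto
  have "concat (map f xs) = concat (map (\<lambda>(m, v). concat (replicate m (f v))) rs')"
    unfolding xs by (induction rs') (auto simp: map_replicate)
  moreover have "card (block_factors N (f v)) \<le> F" if "(m, v) \<in> set rs'" for m v
    using assms(3)[of v] that unfolding xs rs'_def by fastforce
  ultimately have "card (block_factors N (concat (map f xs))) \<le> length rs' * (F + 2 * N)"
    using card_block_factors_runs[OF assms(1), of rs' f F] by simp
  also have "\<dots> \<le> r * (F + 2 * N)"
    using order_trans[OF length_filter_le rs(1)] unfolding rs'_def by (intro mult_right_mono) auto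
  finally show ?thesis .
qed

lemma mset_concat_filter:
  assumes "distinct ks"
  shows "mset (concat (map (\<lambda>k. filter (\<lambda>e. f e = k) xs) ks)) = filter_mset (\<lambda>e. f e \<in> set ks) (mset xs)"
  using assms
proof (induction ks)
  case (Cons k ks)
  then show ?case
    by (simp, intro multiset_eqI) auto
qed simp

lemma has_runs_concat_filter:
  "has_runs (length ks) (map f (concat (map (\<lambda>k. filter (\<lambda>e. f e = k) xs) ks)))"
proof (induction ks)
  case Nil
  then show ?case by (simp add: has_runs_def)
next
  case (Cons k ks)
  have "has_runs (Suc 0) (map f (filter (\<lambda>e. f e = k) xs))"
    by (rule has_runs_constant[of _ k]) auto
  from has_runs_append[OF this Cons] show ?case by simp
qed

text \<open>A block of a tower is encoded as (offset, (letter, tag)).\<close>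

definition reordered ::
    "nat \<Rightarrow> nat \<Rightarrow> nat \<Rightarrow> (nat \<times> nat \<times> nat) list \<Rightarrow> (nat \<times> nat \<times> nat) list \<Rightarrow> bool" where
  "reordered r a e E E' \<longleftrightarrow>
     mset E' = mset E \<and> last E' = last E \<and> has_runs r (map snd E') \<and>
     (\<exists>Zs t rest. E' = (0, (a, 1)) # Zs @ (t, (a, 2)) # rest \<and> length Zs = e \<and>
        (\<forall>z\<in>set Zs. snd z = (a, 0)))"

text \<open>The runs are the first block, \<open>e\<close> copies of \<open>a\<close>, the marked
  block, the remaining copies of \<open>a\<close>, one group for each letter from 0 to
  \<open>D\<close>, and the last block: 4 + (D + 1) + 1. A group for the letter \<open>a\<close> is
  empty, because its blocks of tag 0 have been used before.\<close>

lemma reordered_exists: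
  assumes E: "E = (0, (a, 1)) # M @ [lst]" and M: "M = M1 @ (t, (a, 2)) # M2"
    and tags: "\<And>x. x \<in> set (M1 @ M2) \<Longrightarrow> fst (snd x) \<le> D \<and> snd (snd x) = 0"
    and many: "e \<le> length (filter (\<lambda>x. snd x = (a, 0)) (M1 @ M2))"
  shows "\<exists>E'. reordered (D + 6) a e E E'"
proof -
  define Z where "Z = filter (\<lambda>x. snd x = (a, 0)) (M1 @ M2)"
  define W where "W = filter (\<lambda>x. snd x \<noteq> (a, 0)) (M1 @ M2)"
  define ks where "ks = map (\<lambda>k. (k, 0::nat)) [0..<Suc D]"
  define V where "V = concat (map (\<lambda>k. filter (\<lambda>x. snd x = k) W) ks)"
  define E' where "E' = [(0, (a, 1))] @ take e Z @ [(t, (a, 2))] @ drop e Z @ V @ [lst]"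
  have "snd x \<in> set ks" if "x \<in> set W" for x
    using tags[of x] that unfolding W_def ks_def
    by (cases x) (auto simp del: upt_Suc intro!: image_eqI)
  moreover have "distinct ks" unfolding ks_def by (auto simp: distinct_map inj_on_def simp del: upt_Suc)
  ultimately have mV: "mset V = mset W"
    unfolding V_def by (simp add: mset_concat_filter filter_mset_eq_conv)
  have "mset Z + mset W = mset (M1 @ M2)"
    unfolding Z_def W_def mset_filter by (rule multiset_partition[symmetric])
  moreover have "mset (take e Z) + mset (drop e Z) = mset Z"
    by (metis append_take_drop_id mset_append)
  moreover have "mset E' = {#(0, (a, 1)), (t, (a, 2)), lst#} + (mset (take e Z) + mset (drop e Z)) + mset V"
    unfolding E'_def by (simp add: ac_simps)
  moreover have "mset E = {#(0, (a, 1)), (t, (a, 2)), lst#} + mset (M1 @ M2)"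
    unfolding E M by (simp add: ac_simps)
  ultimately have m: "mset E' = mset E"
    using mV by (metis add.assoc)
  have r1: "has_runs (Suc 0) (map snd [(0, (a, 1::nat))])" by (rule has_runs_constant) simp
  have r2: "has_runs (Suc 0) (map snd [(t, (a, 2::nat))])" by (rule has_runs_constant) simp
  have r3: "has_runs (Suc 0) (map snd [lst])" by (rule has_runs_constant) simp
  have r4: "has_runs (Suc 0) (map snd (take e Z))"
    by (rule has_runs_constant[of _ "(a, 0)"]) (auto simp: Z_def dest!: in_set_takeD)
  have r5: "has_runs (Suc 0) (map snd (drop e Z))"
    by (rule has_runs_constant[of _ "(a, 0)"]) (auto simp: Z_def dest!: in_set_dropD)
  have r6: "has_runs (Suc D) (map snd V)"
    using has_runs_concat_filter[of ks snd W] by (simp add: V_def ks_def)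
  have "has_runs (Suc 0 + (Suc 0 + (Suc 0 + (Suc 0 + (Suc D + Suc 0))))) (map snd E')"
    unfolding E'_def map_append
    by (intro has_runs_append r1 r2 r3 r4 r5 r6)
  then have r: "has_runs (D + 6) (map snd E')" by (simp add: numeral_eq_Suc)
  have "length (take e Z) = e" using many by (simp add: Z_def)
  moreover have "\<forall>z\<in>set (take e Z). snd z = (a, 0)" by (auto simp: Z_def dest!: in_set_takeD)
  ultimately have "\<exists>Zs t rest. E' = (0, (a, 1)) # Zs @ (t, (a, 2)) # rest \<and> length Zs = e \<and>
        (\<forall>z\<in>set Zs. snd z = (a, 0))"
    unfolding E'_def by (metis append_Cons append_Nil)
  moreover have "last E' = last E" by (simp add: E'_def E)
  ultimately show ?thesis using m r unfolding reordered_def by blast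
qed

lemma sorted_le_last: "sorted xs \<Longrightarrow> x \<in> set xs \<Longrightarrow> x \<le> last xs" for xs :: "'b :: linorder list"
  by (induction xs) auto

lemma nth_concat_block:
  assumes "\<And>x. x \<in> set A \<Longrightarrow> length (f x) = g x" and "i < length (f e)"
  shows "concat (map f (A @ e # B)) ! (sum_list (map g A) + i) = f e ! i"
proof -
  have "length (concat (map f A)) = sum_list (map g A)"
    using assms(1) by (simp add: length_concat comp_def cong: map_cong)
  then show ?thesis using assms(2) by (simp add: nth_append)
qed

lemma distinct_concat_map:
  assumes "distinct es" "\<And>e. e \<in> set es \<Longrightarrow> distinct (f e)"
    and "\<And>e e'. e \<in> set es \<Longrightarrow> e' \<in> set es \<Longrightarrow> e \<noteq> e' \<Longrightarrow> set (f e) \<inter> set (f e') = {}"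
  shows "distinct (concat (map f es))"
  using assms
proof (induction es)
  case (Cons e es)
  have "distinct (concat (map f es))" by (rule Cons.IH) (use Cons.prems in auto)
  moreover have "set (f e) \<inter> set (f e') = {}" if "e' \<in> set es" for e'
    using Cons.prems(3)[of e e'] Cons.prems(1) that by auto
  ultimately show ?case using Cons.prems(1,2) by auto
qed simp

section \<open>Integer iterates\<close>

lemma topcontinuous_at_locally_constant:
  assumes "openin X U" "x \<in> U" "\<And>y. y \<in> U \<Longrightarrow> f y = f x"
  shows "topcontinuous_at X (discrete_topology UNIV) f x"
proof -
  have "x \<in> topspace X" using assms(1,2) openin_subset by blast
  moreover have "\<exists>U. openin X U \<and> x \<in> U \<and> (\<forall>y\<in>U. f y \<in> V)" if "f x \<in> V" for V
    using assms that by metis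
  ultimately show ?thesis unfolding topcontinuous_at_def by simp
qed

text \<open>The algebra of integer iterates uses only bijectivity on the carrier, so it is set up
  once for \<open>T\<close>, for the reordered map \<open>R\<close> and for the shift.\<close>

locale bijective_system =
  fixes X :: "'a topology" and T :: "'a \<Rightarrow> 'a"
  assumes bij: "bij_betw T (topspace X) (topspace X)"
begin

lemma T_in: "x \<in> topspace X \<Longrightarrow> T x \<in> topspace X"
  using bij by (auto simp: bij_betw_def)

lemma T_inj: "x \<in> topspace X \<Longrightarrow> y \<in> topspace X \<Longrightarrow> T x = T y \<longleftrightarrow> x = y"
  using bij by (auto simp: bij_betw_def inj_on_def)

lemma T_surj: "y \<in> topspace X \<Longrightarrow> \<exists>x\<in>topspace X. y = T x"
  using bij by (auto simp: bij_betw_def)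

lemma int_iter_0 [simp]: "int_iter X T 0 x = x"
  by (simp add: int_iter_def)

lemma int_iter_1 [simp]: "int_iter X T 1 x = T x"
  by (simp add: int_iter_def)

lemma int_iter_nat: "int_iter X T (int n) x = (T ^^ n) x"
  by (simp add: int_iter_def)

lemma inv_in: "x \<in> topspace X \<Longrightarrow> inv_into (topspace X) T x \<in> topspace X"
  by (metis bij bij_betw_def inv_into_into)

lemma int_iter_in [simp]:
  assumes "x \<in> topspace X" shows "int_iter X T n x \<in> topspace X"
proof -
  have "(T ^^ k) x \<in> topspace X" for k using assms T_in by (induction k) auto
  moreover have "(inv_into (topspace X) T ^^ k) x \<in> topspace X" for k
    using assms inv_in by (induction k) auto
  ultimately show ?thesis by (auto simp: int_iter_def)
qed

lemma int_iter_Suc: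
  assumes "x \<in> topspace X" shows "int_iter X T (n + 1) x = T (int_iter X T n x)"
proof (cases "0 \<le> n")
  case True
  then show ?thesis by (simp add: int_iter_def nat_add_distrib)
next
  case False
  define k where "k = nat (- n) - 1"
  have k: "n = - int (Suc k)" using False by (simp add: k_def)
  have e: "int_iter X T (n + 1) x = (inv_into (topspace X) T ^^ k) x"
    unfolding k by (cases k) (auto simp: int_iter_def nat_add_distrib nat_diff_distrib)
  then have "(inv_into (topspace X) T ^^ k) x \<in> topspace X" using assms int_iter_in by metis
  then have "T (inv_into (topspace X) T ((inv_into (topspace X) T ^^ k) x)) = (inv_into (topspace X) T ^^ k) x"
    using bij by (simp add: bij_betw_def f_inv_into_f)
  moreover have "nat (- n) = Suc k" using k by simp
  ultimately show ?thesis using e False by (simp add: int_iter_def[of _ _ n])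
qed

lemma int_iter_add:
  assumes "x \<in> topspace X"
  shows "int_iter X T (m + n) x = int_iter X T m (int_iter X T n x)"
proof (induction m rule: int_induct[where k = 0])
  case (step1 i)
  have "int_iter X T (i + n + 1) x = T (int_iter X T (i + n) x)"
    using assms int_iter_Suc by blast
  then show ?case using step1 assms int_iter_Suc[of "int_iter X T n x" i] by (simp add: algebra_simps)
next
  case (step2 i)
  have "T (int_iter X T (i - 1 + n) x) = int_iter X T (i + n) x"
    using assms int_iter_Suc[of x "i - 1 + n"] by (simp add: algebra_simps)
  moreover have "T (int_iter X T (i - 1) (int_iter X T n x)) = int_iter X T i (int_iter X T n x)"
    using assms int_iter_Suc[of "int_iter X T n x" "i - 1"] by simp
  ultimately have "T (int_iter X T (i - 1 + n) x) = T (int_iter X T (i - 1) (int_iter X T n x))"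
    using step2 by metis
  then show ?case using assms T_inj by simp
qed simp

lemma int_iter_uminus:
  assumes "x \<in> topspace X" "y = int_iter X T n x" shows "x = int_iter X T (- n) y"
  using assms int_iter_add[of x "- n" n] by simp

text \<open>Forward steps of \<open>R\<close> add an exponent of \<open>T\<close>, backward steps
  subtract one. Applied also with the roles exchanged, this turns the two cocycles into equality of
  orbits.\<close>

lemma orbit_of_subset:
  assumes "bijective_system X R"
    and "\<And>x. x \<in> topspace X \<Longrightarrow> R x \<in> orbit_of X T x" and "x \<in> topspace X"
  shows "orbit_of X R x \<subseteq> orbit_of X T x"
proof -
  interpret R: bijective_system X R by fact
  have "int_iter X R n x \<in> orbit_of X T x" for n
  proof (induction n rule: int_induct[where k = 0])
    case base
    then show ?case unfolding orbit_of_def by (rule range_eqI[of _ _ 0]) simp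
  next
    case (step1 i)
    then obtain m where m: "int_iter X R i x = int_iter X T m x" by (auto simp: orbit_of_def)
    obtain l where "R (int_iter X R i x) = int_iter X T l (int_iter X R i x)"
      using assms(2)[of "int_iter X R i x"] assms(3) by (auto simp: orbit_of_def)
    then have "int_iter X R (i + 1) x = int_iter X T (l + m) x"
      using m assms(3) R.int_iter_Suc int_iter_add by simp
    then show ?case by (auto simp: orbit_of_def)
  next
    case (step2 i)
    then obtain m where m: "int_iter X R i x = int_iter X T m x" by (auto simp: orbit_of_def)
    let ?y = "int_iter X R (i - 1) x"
    obtain l where "R ?y = int_iter X T l ?y"
      using assms(2)[of ?y] assms(3) by (auto simp: orbit_of_def)
    then have "int_iter X T m x = int_iter X T l ?y"
      using m assms(3) R.int_iter_Suc[of x "i - 1"] by simp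
    then have "?y = int_iter X T (- l + m) x"
      using assms(3) int_iter_uminus[of ?y "int_iter X T m x" l] int_iter_add[of x "- l" m]
      by (simp del: uminus_add_conv_diff)
    then show ?case by (auto simp: orbit_of_def)
  qed
  then show ?thesis by (auto simp: orbit_of_def)
qed

lemma int_iter_conj:
  assumes "bijective_system Y S" and "\<phi> ` topspace X \<subseteq> topspace Y"
    and "\<And>x. x \<in> topspace X \<Longrightarrow> \<phi> (T x) = S (\<phi> x)" and "x \<in> topspace X"
  shows "\<phi> (int_iter X T n x) = int_iter Y S n (\<phi> x)"
proof -
  interpret Y: bijective_system Y S by fact
  have in_Y: "\<phi> x \<in> topspace Y" using assms by blast
  show ?thesis
  proof (induction n rule: int_induct[where k = 0])
    case (step1 i)
    then show ?case using assms(3,4) in_Y by (simp add: int_iter_Suc Y.int_iter_Suc)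
  next
    case (step2 i)
    let ?y = "int_iter X T (i - 1) x"
    have "S (\<phi> ?y) = \<phi> (int_iter X T i x)"
      using assms(3,4) int_iter_Suc[of x "i - 1"] by simp
    also have "\<dots> = S (int_iter Y S (i - 1) (\<phi> x))"
      using step2 in_Y Y.int_iter_Suc[of "\<phi> x" "i - 1"] by simp
    finally have "S (\<phi> ?y) = S (int_iter Y S (i - 1) (\<phi> x))" .
    moreover have "\<phi> ?y \<in> topspace Y" using assms(2,4) int_iter_in by blast
    ultimately show ?case using Y.T_inj in_Y by simp
  qed simp
qed

lemma continuous_int_iter:
  assumes "homeomorphic_map X X T" shows "continuous_map X X (int_iter X T n)"
proof -
  have pow: "continuous_map X X (f ^^ k)" if "continuous_map X X f" for f k
    using that by (induction k) (auto intro: continuous_map_compose)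
  obtain g where g: "homeomorphic_maps X X T g" using assms homeomorphic_map_maps by blast
  have "g y = inv_into (topspace X) T y" if "y \<in> topspace X" for y
  proof -
    have gy: "g y \<in> topspace X" "T (g y) = y"
      using g that by (auto simp: homeomorphic_maps_def continuous_map_def)
    then have "inv_into (topspace X) T (T (g y)) = g y"
      using bij by (intro inv_into_f_f) (auto simp: bij_betw_def)
    then show ?thesis using gy by simp
  qed
  then have "continuous_map X X (inv_into (topspace X) T)" "continuous_map X X T"
    using g continuous_map_eq[of X X g] by (auto simp: homeomorphic_maps_def)
  then show ?thesis using pow by (auto simp: int_iter_def)
qed

end

section \<open>Towers with split letters\<close>

text \<open>Partitions are replaced by functions of the point: \<open>K n x\<close> is the tower of
  level n through \<open>x\<close>, and \<open>P n x\<close> the height of \<open>x\<close> above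
  the lowest floor of that tower. In \<open>many\<close>, the point \<open>y\<close> serves to name
  an arbitrary tower of level n.\<close>

locale tower_system =
  fixes X :: "'a topology" and T :: "'a \<Rightarrow> 'a" and K P :: "nat \<Rightarrow> 'a \<Rightarrow> nat"
    and h :: "nat \<Rightarrow> nat \<Rightarrow> nat" and a :: "nat \<Rightarrow> nat" and D :: nat and x0 :: 'a
  assumes homeo: "homeomorphic_map X X T"
    and compact: "compact_space X" and hausdorff: "Hausdorff_space X"
    and K_le: "x \<in> topspace X \<Longrightarrow> K n x \<le> D"
    and P_less: "x \<in> topspace X \<Longrightarrow> P n x < h n (K n x)"
    and P_up: "\<lbrakk>x \<in> topspace X; P n x + 1 < h n (K n x)\<rbrakk> \<Longrightarrow> K n (T x) = K n x \<and> P n (T x) = P n x + 1"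
    and P_top: "\<lbrakk>x \<in> topspace X; P n x + 1 = h n (K n x)\<rbrakk> \<Longrightarrow> P n (T x) = 0"
    and refine: "\<lbrakk>x \<in> topspace X; y \<in> topspace X; K (Suc n) x = K (Suc n) y; P (Suc n) x = P (Suc n) y\<rbrakk>
      \<Longrightarrow> K n x = K n y \<and> P n x = P n y"
    and top_nested: "\<lbrakk>x \<in> topspace X; P (Suc n) x + 1 = h (Suc n) (K (Suc n) x)\<rbrakk> \<Longrightarrow> P n x + 1 = h n (K n x)"
    and bot_nested: "\<lbrakk>x \<in> topspace X; P (Suc n) x = 0\<rbrakk> \<Longrightarrow> P n x = 0 \<and> K n x = a n"
    and open_atom: "openin X {y \<in> topspace X. K n y = k \<and> P n y = p}"
    and basis: "\<lbrakk>openin X U; x \<in> U\<rbrakk> \<Longrightarrow> \<exists>n. \<forall>y\<in>topspace X. K n y = K n x \<and> P n y = P n x \<longrightarrow> y \<in> U"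
    and x0_in: "x0 \<in> topspace X" and x0_top: "P n x0 + 1 = h n (K n x0)"
    and x0_unique: "\<lbrakk>x \<in> topspace X; \<And>n. P n x + 1 = h n (K n x)\<rbrakk> \<Longrightarrow> x = x0"
    and many: "\<lbrakk>x \<in> topspace X; y \<in> topspace X; P (Suc n) x = 0\<rbrakk> \<Longrightarrow>
      3 * D + 10 \<le> card {i. i < h (Suc n) (K (Suc n) x) \<and>
        K n (int_iter X T (int i) x) = K n y \<and> P n (int_iter X T (int i) x) = 0}"

sublocale tower_system \<subseteq> bijective_system X T
proof
  show "bij_betw T (topspace X) (topspace X)"
    using homeo by (metis bij_betw_def homeomorphic_imp_surjective_map homeomorphic_map_def)
qed

context tower_system
begin

abbreviation tz :: "int \<Rightarrow> 'a \<Rightarrow> 'a" where "tz \<equiv> int_iter X T"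

text \<open>By \<open>top_nested\<close>, a point below the top at level n is below the top at level
  n + 1, so neither height is reset. The descent below is the mirror image, with
  \<open>bot_nested\<close>.\<close>

lemma climb_up:
  assumes "x \<in> topspace X" "P n x + i < h n (K n x)"
  shows "K n (tz (int i) x) = K n x \<and> P n (tz (int i) x) = P n x + i \<and>
    K (Suc n) (tz (int i) x) = K (Suc n) x \<and> P (Suc n) (tz (int i) x) = P (Suc n) x + i"
  using assms(2)
proof (induction i)
  case (Suc i)
  let ?y = "tz (int i) x"
  have y: "?y \<in> topspace X" "tz (int (Suc i)) x = T ?y"
    using assms(1) int_iter_Suc[of x "int i"] by (simp_all add: add.commute)
  have IH: "K n ?y = K n x" "P n ?y = P n x + i" "K (Suc n) ?y = K (Suc n) x" "P (Suc n) ?y = P (Suc n) x + i"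
    using Suc by auto
  have lt: "P n ?y + 1 < h n (K n ?y)" using IH Suc.prems by simp
  then have "P (Suc n) ?y + 1 < h (Suc n) (K (Suc n) ?y)"
    using top_nested[OF y(1), of n] P_less[OF y(1), of "Suc n"] by linarith
  then show ?case using P_up[OF y(1) lt] P_up[OF y(1), of "Suc n"] IH y(2) by simp
qed simp

lemma climb_down:
  assumes "x \<in> topspace X" "i \<le> P n x"
  shows "K n (tz (- int i) x) = K n x \<and> P n (tz (- int i) x) + i = P n x \<and>
    K (Suc n) (tz (- int i) x) = K (Suc n) x \<and> P (Suc n) (tz (- int i) x) + i = P (Suc n) x"
  using assms(2)
proof (induction i)
  case (Suc i)
  let ?y = "tz (- int i) x" and ?w = "tz (- int (Suc i)) x"
  have "?y = T ?w" using int_iter_Suc[OF assms(1), of "- int (Suc i)"] by simp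
  note y = int_iter_in[OF assms(1), of "- int i"] int_iter_in[OF assms(1), of "- int (Suc i)"] this
  have IH: "K n ?y = K n x" "P n ?y + i = P n x" "K (Suc n) ?y = K (Suc n) x" "P (Suc n) ?y + i = P (Suc n) x"
    using Suc by auto
  have n0: "P n ?y \<noteq> 0" using IH Suc.prems by linarith
  have up: "K m ?y = K m ?w \<and> P m ?y = P m ?w + 1" if "P m ?y \<noteq> 0" for m
    using P_top[OF y(2), of m] P_up[OF y(2), of m] P_less[OF y(2), of m] that y(3) by fastforce
  have "P (Suc n) ?y \<noteq> 0" using bot_nested[OF y(1), of n] n0 by auto
  then show ?case using up[of n] up[of "Suc n"] n0 IH by auto
qed simp

text \<open>The height at which the block of level n through \<open>x\<close> starts in its tower of
  level n + 1. The subtraction is not truncated, by \<open>P_Suc\<close>, and the value is constant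
  on the block, by \<open>move\<close>.\<close>

definition off :: "nat \<Rightarrow> 'a \<Rightarrow> nat" where "off n x = P (Suc n) x - P n x"

lemma P_Suc: "x \<in> topspace X \<Longrightarrow> P (Suc n) x = off n x + P n x"
  using climb_down[of x "P n x" n] by (auto simp: off_def)

lemma move:
  assumes "x \<in> topspace X" "j < h n (K n x)"
  defines "y \<equiv> tz (int j - int (P n x)) x"
  shows "y \<in> topspace X" "K n y = K n x" "P n y = j" "K (Suc n) y = K (Suc n) x" "off n y = off n x"
proof -
  show y: "y \<in> topspace X" using assms by simp
  have "K n y = K n x \<and> P n y = j \<and> K (Suc n) y = K (Suc n) x \<and> off n y = off n x"
  proof (cases "P n x \<le> j")
    case True
    then have "y = tz (int (j - P n x)) x" using y_def by (simp add: of_nat_diff)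
    then show ?thesis using climb_up[of x n "j - P n x"] assms True by (auto simp: off_def)
  next
    case False
    then have "y = tz (- int (P n x - j)) x" using y_def by (simp add: of_nat_diff)
    then show ?thesis using climb_down[of x "P n x - j" n] assms False by (auto simp: off_def)
  qed
  then show "K n y = K n x" "P n y = j" "K (Suc n) y = K (Suc n) x" "off n y = off n x" by auto
qed

lemma reach:
  assumes "k \<in> K n ` topspace X" "j < h n k"
  obtains x where "x \<in> topspace X" "K n x = k" "P n x = j"
  using assms move by (metis imageE)

text \<open>\<open>refine\<close> makes \<open>fk\<close> and \<open>fp\<close> independent of the
  chosen point of the floor \<open>j\<close>; for a floor that does not exist they are
  arbitrary.\<close>

definition fk :: "nat \<Rightarrow> nat \<Rightarrow> nat \<Rightarrow> nat" where
  "fk n k j = K n (SOME x. x \<in> topspace X \<and> K (Suc n) x = k \<and> P (Suc n) x = j)"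

definition fp :: "nat \<Rightarrow> nat \<Rightarrow> nat \<Rightarrow> nat" where
  "fp n k j = P n (SOME x. x \<in> topspace X \<and> K (Suc n) x = k \<and> P (Suc n) x = j)"

lemma fk_fp:
  assumes "x \<in> topspace X"
  shows "fk n (K (Suc n) x) (P (Suc n) x) = K n x" "fp n (K (Suc n) x) (P (Suc n) x) = P n x"
proof -
  let ?Q = "\<lambda>y. y \<in> topspace X \<and> K (Suc n) y = K (Suc n) x \<and> P (Suc n) y = P (Suc n) x"
  have "?Q (Eps ?Q)" by (rule someI[of ?Q x]) (use assms in simp)
  then show "fk n (K (Suc n) x) (P (Suc n) x) = K n x" "fp n (K (Suc n) x) (P (Suc n) x) = P n x"
    unfolding fk_def fp_def using refine[of "Eps ?Q" x n] assms by auto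
qed

section \<open>Block starts, tags and names of towers\<close>

definition starts :: "nat \<Rightarrow> nat \<Rightarrow> nat list" where
  "starts n k = filter (\<lambda>j. fp n k j = 0) [0..<h (Suc n) k]"

definition second :: "nat \<Rightarrow> nat \<Rightarrow> nat" where
  "second n k = (LEAST j. 0 < j \<and> j < h (Suc n) k \<and> fp n k j = 0 \<and> fk n k j = a n)"

definition tag :: "nat \<Rightarrow> nat \<Rightarrow> nat \<Rightarrow> nat" where
  "tag n k j = (if j = 0 then 1 else if j = second n k then 2 else 0)"

definition blocks :: "nat \<Rightarrow> nat \<Rightarrow> (nat \<times> nat \<times> nat) list" where
  "blocks n k = map (\<lambda>j. (j, fk n k j, tag n k j)) (starts n k)"

text \<open>The split letter of \<open>x\<close>. Its tag depends on the place of the block in the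
  tower of level n + 1, so it can be read off the floor of level n + 1.\<close>

definition C :: "nat \<Rightarrow> 'a \<Rightarrow> nat \<times> nat" where
  "C n x = (K n x, tag n (K (Suc n) x) (off n x))"

definition valid :: "nat \<Rightarrow> nat \<times> nat \<Rightarrow> bool" where
  "valid n c \<longleftrightarrow> fst c \<in> K n ` topspace X \<and> snd c \<le> 2"

definition enc :: "nat \<times> nat \<Rightarrow> nat" where "enc c = 3 * fst c + snd c"

text \<open>The order depends on the tag in \<open>c\<close> and not only on the tower: this is how
  a tag becomes visible one level further down.\<close>

definition block_order :: "nat \<Rightarrow> nat \<times> nat \<Rightarrow> (nat \<times> nat \<times> nat) list" where
  "block_order n c = (SOME E. reordered (D + 6) (a n) (enc c) (blocks n (fst c)) E)"

lemma fst_C [simp]: "fst (C n x) = K n x" by (simp add: C_def)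

lemma C_valid [simp]: "x \<in> topspace X \<Longrightarrow> valid n (C n x)"
  by (auto simp: C_def valid_def tag_def)

lemma valid_le: "valid n c \<Longrightarrow> fst c \<le> D \<and> snd c \<le> 2"
  using K_le by (auto simp: valid_def)

lemma enc_inj: "valid n c \<Longrightarrow> valid n c' \<Longrightarrow> enc c = enc c' \<Longrightarrow> c = c'"
  using valid_le[of n c] valid_le[of n c'] unfolding enc_def
  by (intro prod_eqI; presburger)

lemma C_move:
  assumes "x \<in> topspace X" "j < h n (K n x)"
  shows "C n (tz (int j - int (P n x)) x) = C n x"
  using move[OF assms] by (simp add: C_def)

lemma block_of_point:
  assumes x: "x \<in> topspace X" shows "(off n x, C n x) \<in> set (blocks n (K (Suc n) x))"
proof -
  let ?y = "tz (int 0 - int (P n x)) x"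
  have 0: "0 < h n (K n x)" using P_less[OF x, of n] by simp
  note y = move[OF x 0]
  have "P (Suc n) ?y = off n x" using P_Suc[OF y(1), of n] y by simp
  then have "fp n (K (Suc n) x) (off n x) = 0" "fk n (K (Suc n) x) (off n x) = K n x"
     "off n x < h (Suc n) (K (Suc n) x)"
    using fk_fp[OF y(1), of n] y P_less[OF y(1), of "Suc n"] by auto
  then show ?thesis by (auto simp: blocks_def starts_def C_def)
qed

lemma point_of_block:
  assumes k: "k \<in> K (Suc n) ` topspace X" and "(p, l) \<in> set (blocks n k)"
  obtains x where "x \<in> topspace X" "K (Suc n) x = k" "P (Suc n) x = p" "off n x = p" "P n x = 0" "C n x = l"
proof -
  have p: "p < h (Suc n) k" "fp n k p = 0" "l = (fk n k p, tag n k p)"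
    using assms(2) by (auto simp: blocks_def starts_def)
  obtain x where x: "x \<in> topspace X" "K (Suc n) x = k" "P (Suc n) x = p"
    using reach[OF k p(1)] .
  have "P n x = 0" "fk n k p = K n x" using fk_fp[OF x(1), of n] p x by auto
  then have "off n x = p" "C n x = l" using x p P_Suc[OF x(1), of n] by (auto simp: C_def)
  then show ?thesis using that x \<open>P n x = 0\<close> by blast
qed

lemma block_order_reordered:
  assumes c: "fst c \<in> K (Suc n) ` topspace X" "fst c \<le> D" "snd c \<le> 2"
  shows "reordered (D + 6) (a n) (enc c) (blocks n (fst c)) (block_order n c)"
proof -
  define k where "k = fst c"
  define H where "H = h (Suc n) k"
  obtain w where "w \<in> topspace X" "K (Suc n) w = k" using c(1) k_def by auto
  then have H0: "0 < H" using P_less[of w "Suc n"] unfolding H_def by simp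
  obtain z where z: "z \<in> topspace X" "K (Suc n) z = k" "P (Suc n) z = 0"
    using reach[of k "Suc n" 0] c(1) H0 by (auto simp: k_def H_def)
  have z0: "P n z = 0" "K n z = a n" using bot_nested[OF z(1,3)] by auto
  have fz: "K n (tz (int i) z) = fk n k i" "P n (tz (int i) z) = fp n k i" if "i < H" for i
    using fk_fp[of "tz (int i) z" n] climb_up[OF z(1), of "Suc n" i] that z by (auto simp: H_def)
  define A where "A = {i. i < H \<and> fk n k i = a n \<and> fp n k i = 0}"
  have "A = {i. i < h (Suc n) (K (Suc n) z) \<and> K n (tz (int i) z) = K n z \<and> P n (tz (int i) z) = 0}"
    unfolding A_def using fz z z0 by (auto simp: H_def)
  then have cA: "3 * D + 10 \<le> card A" using many[OF z(1) z(1) z(3)] by simp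
  have finA: "finite A" unfolding A_def by simp
  have f0: "fk n k 0 = a n" "fp n k 0 = 0" using fz[OF H0] z0 by simp_all
  define ss where "ss = filter (\<lambda>j. fp n k j = 0) [1..<H]"
  have st: "starts n k = 0 # ss"
    using H0 f0 by (simp add: starts_def ss_def upt_conv_Cons flip: H_def)
  have sorted_ss: "sorted_wrt (<) ss" unfolding ss_def by (simp add: sorted_wrt_filter)
  have A_ss: "A - {0} \<subseteq> set ss" unfolding A_def ss_def by auto
  define t where "t = second n k"
  have "card (A - {0}) \<noteq> 0" using cA finA card_Diff_singleton_if[of A 0] by simp
  then obtain s where "s \<in> A - {0}" by (metis card.empty ex_in_conv)
  then have t: "t \<in> A" "t \<noteq> 0"
    using LeastI[of "\<lambda>j. 0 < j \<and> j < h (Suc n) k \<and> fp n k j = 0 \<and> fk n k j = a n" s]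
    unfolding t_def second_def A_def H_def by auto
  have t_least: "t \<le> j" if "j \<in> A" "j \<noteq> 0" for j
    unfolding t_def second_def using that by (intro Least_le) (auto simp: A_def H_def)
  \<comment> \<open>A third occurrence of \<open>a n\<close> lies beyond the second one
    \<open>t\<close>, so the marked block is not the last block, which has to keep its
    place.\<close>
  have "card {0, t} \<le> 2" by (simp add: card_insert_if)
  then have "\<not> A \<subseteq> {0, t}" using cA card_mono[of "{0, t}" A] by fastforce
  then obtain t' where t': "t' \<in> A" "t' \<noteq> 0" "t' \<noteq> t" by auto
  have t_ss: "t \<in> set ss" "t' \<in> set ss" using t t' A_ss by auto
  define mid where "mid = butlast ss"
  define e where "e = last ss"
  have ss: "ss = mid @ [e]" using t_ss by (metis append_butlast_last_id e_def empty_iff list.set(1) mid_def)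
  have "t \<noteq> e"
    using t_least[OF t'(1,2)] t' t_ss sorted_ss unfolding ss by (auto simp: sorted_wrt_append)
  then have "t \<in> set mid" using t_ss ss by simp
  then obtain m1 m2 where mid: "mid = m1 @ t # m2" by (meson split_list)
  define g where "g = (\<lambda>j. (j, fk n k j, tag n k j))"
  have dist: "distinct ss" by (simp add: ss_def)
  have tagz: "tag n k j = 0" if "j \<in> set (m1 @ m2)" for j
  proof -
    have "j \<in> set ss" "j \<noteq> t" using that dist unfolding ss mid by auto
    moreover from this have "j \<noteq> 0" by (auto simp: ss_def)
    ultimately show ?thesis by (simp add: tag_def t_def)
  qed
  have B: "blocks n k = (0, (a n, 1)) # (map g mid) @ [g e]"
    unfolding blocks_def st ss g_def using f0 by (simp add: tag_def)
  have Bm: "map g mid = map g m1 @ (t, (a n, 2)) # map g m2"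
    unfolding mid g_def using t t_def by (simp add: tag_def A_def)
  have "\<exists>E. reordered (D + 6) (a n) (enc c) (blocks n k) E"
  proof (rule reordered_exists[OF B Bm])
    fix x assume "x \<in> set (map g m1 @ map g m2)"
    then obtain j where j: "x = g j" "j \<in> set (m1 @ m2)" by auto
    then have "j \<in> set ss" unfolding ss mid by auto
    then have "j < H" by (simp add: ss_def)
    then have "fk n k j \<le> D" using fz[of j] K_le[of "tz (int j) z" n] z by simp
    then show "fst (snd x) \<le> D \<and> snd (snd x) = 0" using j tagz by (auto simp: g_def)
  next
    \<comment> \<open>At most three occurrences are lost to the first, the marked and the last
      block; the other \<open>3 * D + 7\<close> suffice for
      \<open>enc c \<le> 3 * D + 2\<close>.\<close>
    have "A - {0, t, e} \<subseteq> {j \<in> set (m1 @ m2). fk n k j = a n}"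
      using A_ss ss mid by (auto simp: A_def)
    then have "card (A - {0, t, e}) \<le> card {j \<in> set (m1 @ m2). fk n k j = a n}"
      by (rule card_mono[rotated]) simp
    moreover have "card A - card {0, t, e} \<le> card (A - {0, t, e})" by (rule diff_card_le_card_Diff) simp
    moreover have "card {0, t, e} \<le> 3" by (simp add: card_insert_if)
    moreover have "{j \<in> set (m1 @ m2). fk n k j = a n} = set (filter (\<lambda>j. snd (g j) = (a n, 0)) (m1 @ m2))"
      using tagz by (auto simp: g_def)
    moreover have "distinct (filter (\<lambda>j. snd (g j) = (a n, 0)) (m1 @ m2))"
      using dist unfolding ss mid by auto
    ultimately have "3 * D + 7 \<le> length (filter (\<lambda>j. snd (g j) = (a n, 0)) (m1 @ m2))"
      using cA by (simp only: distinct_card)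
    moreover have "enc c \<le> 3 * D + 2" using c by (simp add: enc_def)
    ultimately show "enc c \<le> length (filter (\<lambda>x. snd x = (a n, 0)) (map g m1 @ map g m2))"
      by (simp add: filter_map comp_def)
  qed
  then show ?thesis unfolding block_order_def k_def by (rule someI_ex)
qed

end

section \<open>The new order of the floors\<close>

context tower_system
begin

lemma valid_block:
  assumes "k \<in> K (Suc n) ` topspace X" "(p, l) \<in> set (blocks n k)" shows "valid n l"
  using point_of_block[OF assms] C_valid by metis

lemma block_order_spec:
  assumes "valid (Suc n) c"
  shows "reordered (D + 6) (a n) (enc c) (blocks n (fst c)) (block_order n c)"
  using assms valid_le[OF assms] by (intro block_order_reordered) (auto simp: valid_def)

lemma set_block_order: "valid (Suc n) c \<Longrightarrow> set (block_order n c) = set (blocks n (fst c))"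
  using block_order_spec by (metis reordered_def mset_eq_setD)

lemma distinct_block_order: "valid (Suc n) c \<Longrightarrow> distinct (block_order n c)"
  using block_order_spec[of n c] mset_eq_imp_distinct_iff[of "block_order n c" "blocks n (fst c)"]
  by (auto simp: reordered_def blocks_def starts_def distinct_map inj_on_def)

lemma valid_block_order: "valid (Suc n) c \<Longrightarrow> (p, l) \<in> set (block_order n c) \<Longrightarrow> valid n l"
  using valid_block set_block_order by (metis valid_def)

text \<open>\<open>L n c\<close> lists the floors of the tower \<open>fst c\<close> of level \<open>n\<close>, numbered by height, in the
  order in which the new system visits them when it climbs the tower named \<open>c\<close>.\<close>

primrec L :: "nat \<Rightarrow> nat \<times> nat \<Rightarrow> nat list" where
  "L 0 c = [0..<h 0 (fst c)]"
| "L (Suc n) c = concat (map (\<lambda>e. map ((+) (fst e)) (L n (snd e))) (block_order n c))"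

text \<open>The top floor of the tower is a top floor at level n as well, so its block ends there.
  No block starts later, since such a start would lie at positive height inside that block.\<close>

lemma top_block:
  assumes k: "k \<in> K (Suc n) ` topspace X" and last: "last (blocks n k) = (p, l)"
    and "blocks n k \<noteq> []"
  shows "p + h n (fst l) = h (Suc n) k"
proof -
  obtain w where w: "w \<in> topspace X" "K (Suc n) w = k" using k by auto
  have H: "0 < h (Suc n) k" using P_less[OF w(1), of "Suc n"] w by simp
  obtain x where x: "x \<in> topspace X" "K (Suc n) x = k" "P (Suc n) x = h (Suc n) k - 1"
    using reach[OF k, of "h (Suc n) k - 1"] H by auto
  have top: "P n x + 1 = h n (K n x)" using top_nested[OF x(1)] x H by simp
  have "(p, l) \<in> set (blocks n k)" using last assms(3) by (metis last_in_set)
  then obtain z where z: "z \<in> topspace X" "K (Suc n) z = k" "P (Suc n) z = p" "P n z = 0" "C n z = l"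
    using point_of_block[OF k] by metis
  have "off n x \<in> set (starts n k)" "starts n k \<noteq> []"
    using block_of_point[OF x(1), of n] x by (auto simp: blocks_def)
  moreover have "p = last (starts n k)" using last \<open>starts n k \<noteq> []\<close> by (simp add: blocks_def last_map)
  moreover have "sorted (starts n k)" unfolding starts_def by (simp add: sorted_wrt_filter)
  ultimately have le: "off n x \<le> p" using sorted_le_last by metis
  have "p \<le> off n x"
  proof (rule ccontr)
    assume "\<not> p \<le> off n x"
    have pl: "p < h (Suc n) k" using P_less[OF z(1), of "Suc n"] z by simp
    have e: "off n x + P n x = h (Suc n) k - 1" using P_Suc[OF x(1), of n] x by simp
    have j: "p - off n x < h n (K n x)" using pl e top by linarith
    let ?y = "tz (int (p - off n x) - int (P n x)) x"
    note y = move[OF x(1) j]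
    have "P (Suc n) ?y = p" using P_Suc[OF y(1), of n] y le by simp
    then have "P n ?y = P n z" using refine[OF y(1) z(1), of n] y z x by simp
    then show False using y z \<open>\<not> p \<le> off n x\<close> by simp
  qed
  then have "p = off n x" using le by simp
  then have "P n z = P n (tz (int 0 - int (P n x)) x)" "K n z = K n x"
    using refine[OF z(1) move(1)[OF x(1), of 0 n], of n] move[OF x(1), of 0 n] P_Suc[of _ n] x z top by auto
  then show ?thesis using \<open>p = off n x\<close> P_Suc[OF x(1), of n] x z top H by (auto simp flip: z(5))
qed

text \<open>The blocks tile the tower, hence any order of them lists every floor once. The end
  floors stay in place because the end blocks do and, by induction, the end floors of these blocks
  do.\<close>

lemma L_spec:
  assumes "valid n c"
  shows "distinct (L n c) \<and> set (L n c) = {0..<h n (fst c)} \<and> L n c \<noteq> [] \<and> hd (L n c) = 0 \<and>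
    last (L n c) = h n (fst c) - 1"
  using assms
proof (induction n arbitrary: c)
  case 0
  then obtain x where "x \<in> topspace X" "K 0 x = fst c" by (auto simp: valid_def)
  then have "0 < h 0 (fst c)" using P_less[of x 0] by simp
  then show ?case by (simp add: last_conv_nth)
next
  case (Suc n)
  define k where "k = fst c"
  have k: "k \<in> K (Suc n) ` topspace X" using Suc.prems by (simp add: valid_def k_def)
  let ?f = "\<lambda>e. map ((+) (fst e)) (L n (snd e))"
  have IH: "distinct (L n (snd e))" "set (L n (snd e)) = {0..<h n (fst (snd e))}" "L n (snd e) \<noteq> []"
    "hd (L n (snd e)) = 0" "last (L n (snd e)) = h n (fst (snd e)) - 1"
    if "e \<in> set (block_order n c)" for e
    using Suc.IH[of "snd e"] valid_block_order[OF Suc.prems, of "fst e" "snd e"] that by auto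
  have so: "set (block_order n c) = set (blocks n k)" using set_block_order[OF Suc.prems] by (simp add: k_def)
  have setf: "set (?f e) = {fst e..<fst e + h n (fst (snd e))}" if "e \<in> set (block_order n c)" for e
    using IH[OF that] by (simp add: add.commute)
  \<comment> \<open>A floor \<open>j\<close> determines the start \<open>j - fp n k j\<close> of its
    block, which makes blocks with different starts disjoint.\<close>
  have mem: "j < h (Suc n) k \<and> j - fp n k j = fst e"
    if e: "e \<in> set (block_order n c)" and j: "j \<in> set (?f e)" for e j
  proof -
    obtain x where x: "x \<in> topspace X" "K (Suc n) x = k" "P (Suc n) x = fst e" "off n x = fst e" "P n x = 0" "C n x = snd e"
      using point_of_block[OF k, of "fst e" "snd e"] e so by auto
    have "fst (snd e) = K n x" using x(6) fst_C by metis
    then have j': "j - fst e < h n (K n x)" "fst e \<le> j" using j setf[OF e] by auto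
    note y = move[OF x(1) j'(1)]
    let ?y = "tz (int (j - fst e) - int (P n x)) x"
    have "P (Suc n) ?y = j" using P_Suc[OF y(1), of n] y x j' by simp
    then show ?thesis using fk_fp[OF y(1), of n] y x P_less[OF y(1), of "Suc n"] j' by auto
  qed
  have d: "distinct (L (Suc n) c)" unfolding L.simps
  proof (rule distinct_concat_map)
    show "distinct (block_order n c)" by (rule distinct_block_order[OF Suc.prems])
    show "distinct (?f e)" if "e \<in> set (block_order n c)" for e using IH[OF that] by (simp add: distinct_map)
    show "set (?f e) \<inter> set (?f e') = {}"
      if e: "e \<in> set (block_order n c)" "e' \<in> set (block_order n c)" "e \<noteq> e'" for e e'
    proof -
      have "fst e \<noteq> fst e'" using e unfolding so by (auto simp: blocks_def)
      then show ?thesis using mem[OF e(1)] mem[OF e(2)] by fastforce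
    qed
  qed
  have s: "set (L (Suc n) c) = {0..<h (Suc n) k}"
  proof
    show "set (L (Suc n) c) \<subseteq> {0..<h (Suc n) k}" using mem by auto
    show "{0..<h (Suc n) k} \<subseteq> set (L (Suc n) c)"
    proof
      fix j assume "j \<in> {0..<h (Suc n) k}"
      then obtain x where x: "x \<in> topspace X" "K (Suc n) x = k" "P (Suc n) x = j"
        using reach[OF k] by auto
      have b: "(off n x, C n x) \<in> set (block_order n c)" using block_of_point[OF x(1), of n] x so by simp
      have "?f (off n x, C n x) \<in> set (map ?f (block_order n c))" using b unfolding set_map by (rule imageI)
      moreover have "j \<in> set (?f (off n x, C n x))"
        using setf[OF b] P_Suc[OF x(1), of n] P_less[OF x(1), of n] x by simp
      ultimately show "j \<in> set (L (Suc n) c)" unfolding L.simps set_concat by (rule UN_I)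
    qed
  qed
  obtain rest where rest: "block_order n c = (0, (a n, 1)) # rest" and last: "last (block_order n c) = last (blocks n k)"
    using block_order_spec[OF Suc.prems] unfolding reordered_def k_def by blast
  have hd: "L (Suc n) c \<noteq> []" "hd (L (Suc n) c) = 0"
    using IH[of "(0, (a n, 1))"] rest by (auto simp: hd_append hd_map)
  define e where "e = last (blocks n k)"
  have e: "e \<in> set (block_order n c)" "block_order n c = butlast (block_order n c) @ [e]"
    using rest last by (metis e_def last_in_set list.distinct(1), metis append_butlast_last_id e_def list.distinct(1))
  have "blocks n k \<noteq> []" using so rest by auto
  then have "fst e + h n (fst (snd e)) = h (Suc n) k"
    using top_block[OF k, of "fst e" "snd e"] by (simp add: e_def)
  moreover have "last (L (Suc n) c) = last (?f e)"
    using IH(3)[OF e(1)] by (subst L.simps, subst e(2)) simp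
  moreover have "last (?f e) = fst e + (h n (fst (snd e)) - 1)" using IH[OF e(1)] by (simp add: last_map)
  moreover have "0 < h n (fst (snd e))" using IH(2,3)[OF e(1)] by (cases "h n (fst (snd e))") auto
  ultimately have "last (L (Suc n) c) = h (Suc n) k - 1" by linarith
  then show ?case using d s hd by (simp add: k_def)
qed

lemma set_L: "valid n c \<Longrightarrow> set (L n c) = {0..<h n (fst c)}"
  using L_spec by blast

lemma length_L: "valid n c \<Longrightarrow> length (L n c) = h n (fst c)"
  using L_spec[of n c] distinct_card[of "L n c"] by simp

lemma height_pos: "valid n c \<Longrightarrow> 0 < h n (fst c)"
  using L_spec[of n c] length_L[of n c] by (metis length_greater_0_conv)

lemma L_0: "valid n c \<Longrightarrow> L n c ! 0 = 0"
  using L_spec[of n c] by (metis hd_conv_nth)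

lemma L_top: "valid n c \<Longrightarrow> L n c ! (h n (fst c) - 1) = h n (fst c) - 1"
  using L_spec[of n c] length_L[of n c] by (metis last_conv_nth)

lemma L_less: "valid n c \<Longrightarrow> i < h n (fst c) \<Longrightarrow> L n c ! i < h n (fst c)"
  using L_spec[of n c] length_L[of n c] by (metis atLeastLessThan_iff nth_mem)

lemma L_inj: "valid n c \<Longrightarrow> i < h n (fst c) \<Longrightarrow> j < h n (fst c) \<Longrightarrow> L n c ! i = L n c ! j \<longleftrightarrow> i = j"
  using L_spec[of n c] length_L[of n c] by (simp add: nth_eq_iff_index_eq)

text \<open>The counterpart of \<open>P\<close> for the new order: the number of floors visited
  before the floor of \<open>x\<close>.\<close>

definition q :: "nat \<Rightarrow> 'a \<Rightarrow> nat" where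
  "q n x = (THE i. i < h n (K n x) \<and> L n (C n x) ! i = P n x)"

lemma q_unique:
  assumes "x \<in> topspace X" "i < h n (K n x)" "L n (C n x) ! i = P n x" shows "q n x = i"
  unfolding q_def using assms L_inj[OF C_valid[OF assms(1)], of _ n i] by (intro the_equality) auto

lemma q_spec:
  assumes "x \<in> topspace X" shows "q n x < h n (K n x)" "L n (C n x) ! q n x = P n x"
proof -
  have "P n x \<in> set (L n (C n x))" using set_L[OF C_valid[OF assms], of n] P_less[OF assms, of n] by simp
  then obtain i where i: "i < h n (K n x)" "L n (C n x) ! i = P n x"
    using length_L[OF C_valid[OF assms], of n] by (auto simp: in_set_conv_nth)
  then show "q n x < h n (K n x)" "L n (C n x) ! q n x = P n x"
    using q_unique[OF assms i] by simp_all
qed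

text \<open>The new order fixes the end floors, so the bottom of a tower, and by
  \<open>q_top_iff\<close> its top, means the same in both orders. This ties the two systems
  together near \<open>x0\<close>.\<close>

lemma q_0_iff: assumes "x \<in> topspace X" shows "q n x = 0 \<longleftrightarrow> P n x = 0"
  using q_spec[OF assms, of n] q_unique[OF assms, of 0 n] L_0[OF C_valid[OF assms], of n] by auto

lemma q_top_iff: assumes "x \<in> topspace X" shows "q n x + 1 = h n (K n x) \<longleftrightarrow> P n x + 1 = h n (K n x)"
  using q_spec[OF assms, of n] q_unique[OF assms, of "h n (K n x) - 1" n] L_top[OF C_valid[OF assms], of n]
    P_less[OF assms, of n] by (cases "h n (K n x)") auto

lemma block_location:
  assumes x: "x \<in> topspace X"
  obtains A B where "block_order n (C (Suc n) x) = A @ (off n x, C n x) # B"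
    "q (Suc n) x = sum_list (map (\<lambda>e. h n (fst (snd e))) A) + q n x"
proof -
  let ?c = "C (Suc n) x"
  have v: "valid (Suc n) ?c" using x by simp
  have "(off n x, C n x) \<in> set (block_order n ?c)" using block_of_point[OF x] set_block_order[OF v] by simp
  then obtain A B where AB: "block_order n ?c = A @ (off n x, C n x) # B" by (meson split_list)
  have len: "length (map ((+) (fst e)) (L n (snd e))) = h n (fst (snd e))" if "e \<in> set (block_order n ?c)" for e
    using length_L[of n "snd e"] valid_block_order[OF v, of "fst e" "snd e"] that by simp
  let ?u = "sum_list (map (\<lambda>e. h n (fst (snd e))) A)"
  have lc: "length (L n (C n x)) = h n (K n x)" using length_L[OF C_valid[OF x], of n] by simp
  have "length (L (Suc n) ?c) = ?u + h n (K n x) + sum_list (map (\<lambda>e. h n (fst (snd e))) B)"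
    using len lc unfolding L.simps AB by (simp add: length_concat comp_def cong: map_cong)
  then have "?u + q n x < h (Suc n) (K (Suc n) x)"
    using length_L[OF v] q_spec[OF x, of n] by simp
  moreover have "L (Suc n) ?c ! (?u + q n x) = map ((+) (off n x)) (L n (C n x)) ! q n x"
    using nth_concat_block[of A "\<lambda>e. map ((+) (fst e)) (L n (snd e))" "\<lambda>e. h n (fst (snd e))"
        "q n x" "(off n x, C n x)" B] len lc q_spec(1)[OF x, of n] unfolding L.simps AB by simp
  then have "L (Suc n) ?c ! (?u + q n x) = P (Suc n) x"
    using q_spec[OF x, of n] length_L[of n "C n x"] x P_Suc[OF x, of n] by simp
  ultimately have "q (Suc n) x = ?u + q n x" using q_unique[OF x, of _ "Suc n"] by simp
  then show ?thesis using that AB by blast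
qed

end

section \<open>The reordered system\<close>

context tower_system
begin

definition jump :: "nat \<Rightarrow> 'a \<Rightarrow> int" where
  "jump n x = int (L n (C n x) ! (q n x + 1)) - int (P n x)"

definition inside :: "nat \<Rightarrow> 'a \<Rightarrow> bool" where
  "inside n x \<longleftrightarrow> q n x + 1 < h n (K n x)"

text \<open>As soon as \<open>x\<close> is not on top at some level, the next floor of that tower is
  known. Only \<open>x0\<close> is on top at all levels, and there the value 1 makes
  \<open>R\<close> agree with \<open>T\<close>.\<close>

definition cocycle :: "'a \<Rightarrow> int" where
  "cocycle x = (if \<exists>n. inside n x then jump (LEAST n. inside n x) x else 1)"

definition R :: "'a \<Rightarrow> 'a" where "R x = tz (cocycle x) x"

lemma q_Suc:
  assumes x: "x \<in> topspace X"
  obtains u where "q (Suc n) x = u + q n x" "u + h n (K n x) \<le> h (Suc n) (K (Suc n) x)"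
    "\<And>i. i < h n (K n x) \<Longrightarrow> L (Suc n) (C (Suc n) x) ! (u + i) = off n x + L n (C n x) ! i"
proof -
  let ?c = "C (Suc n) x"
  obtain A B where AB: "block_order n ?c = A @ (off n x, C n x) # B"
    and q: "q (Suc n) x = sum_list (map (\<lambda>e. h n (fst (snd e))) A) + q n x"
    using block_location[OF x] .
  let ?u = "sum_list (map (\<lambda>e. h n (fst (snd e))) A)"
  have v: "valid (Suc n) ?c" using x by simp
  have len: "length (map ((+) (fst e)) (L n (snd e))) = h n (fst (snd e))" if "e \<in> set (block_order n ?c)" for e
    using length_L[of n "snd e"] valid_block_order[OF v, of "fst e" "snd e"] that by simp
  have lc: "length (L n (C n x)) = h n (K n x)" using length_L[OF C_valid[OF x], of n] by simp
  have "length (L (Suc n) ?c) = ?u + h n (K n x) + sum_list (map (\<lambda>e. h n (fst (snd e))) B)"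
    using len lc unfolding L.simps AB by (simp add: length_concat comp_def cong: map_cong)
  then have "?u + h n (K n x) \<le> h (Suc n) (K (Suc n) x)" using length_L[OF v] by simp
  moreover have "L (Suc n) ?c ! (?u + i) = off n x + L n (C n x) ! i" if "i < h n (K n x)" for i
    using nth_concat_block[of A "\<lambda>e. map ((+) (fst e)) (L n (snd e))" "\<lambda>e. h n (fst (snd e))"
        i "(off n x, C n x)" B] len lc that unfolding L.simps AB by simp
  ultimately show ?thesis using that q by blast
qed

text \<open>A block stays contiguous in the order of the next level, and its inner order is copied
  with a shift by \<open>off n x\<close>. Hence a step inside a block does not depend on the level
  at which it is computed.\<close>

lemma inside_Suc:
  assumes x: "x \<in> topspace X" and "inside n x"
  shows "inside (Suc n) x \<and> jump (Suc n) x = jump n x"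
proof -
  obtain u where u: "q (Suc n) x = u + q n x" "u + h n (K n x) \<le> h (Suc n) (K (Suc n) x)"
    "\<And>i. i < h n (K n x) \<Longrightarrow> L (Suc n) (C (Suc n) x) ! (u + i) = off n x + L n (C n x) ! i"
    using q_Suc[OF x, of n] by blast
  have "inside (Suc n) x" using u assms(2) by (simp add: inside_def)
  moreover have "L (Suc n) (C (Suc n) x) ! (q (Suc n) x + 1) = off n x + L n (C n x) ! (q n x + 1)"
    using u(1) u(3)[of "q n x + 1"] assms(2) by (simp add: inside_def)
  then have "jump (Suc n) x = jump n x" using P_Suc[OF x, of n] by (simp add: jump_def)
  ultimately show ?thesis ..
qed

lemma cocycle_inside:
  assumes x: "x \<in> topspace X" and "inside n x" shows "cocycle x = jump n x"
proof -
  define m where "m = (LEAST n. inside n x)"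
  have m: "inside m x" "m \<le> n" unfolding m_def using assms by (auto intro: LeastI Least_le)
  have "inside n x \<and> jump n x = jump m x" using \<open>m \<le> n\<close>
  proof (induction rule: dec_induct)
    case (step i)
    then show ?case using inside_Suc[OF x, of i] by simp
  qed (use m in simp)
  then show ?thesis using assms(2) unfolding cocycle_def m_def by auto
qed

lemma not_inside_iff:
  assumes x: "x \<in> topspace X" shows "\<not> inside n x \<longleftrightarrow> P n x + 1 = h n (K n x)"
  using q_top_iff[OF x, of n] q_spec(1)[OF x, of n] by (auto simp: inside_def)

lemma inside_exists: "x \<in> topspace X \<Longrightarrow> x \<noteq> x0 \<Longrightarrow> \<exists>n. inside n x"
  using x0_unique not_inside_iff by blast

lemma not_inside_x0: "\<not> inside n x0"
  using not_inside_iff x0_in x0_top by simp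

lemma R_in [simp]: "x \<in> topspace X \<Longrightarrow> R x \<in> topspace X"
  by (simp add: R_def)

lemma R_x0: "R x0 = T x0"
  using not_inside_x0 by (simp add: R_def cocycle_def)

lemma R_inside:
  assumes x: "x \<in> topspace X" and i: "inside n x"
  shows "R x = tz (jump n x) x" "C n (R x) = C n x" "q n (R x) = q n x + 1"
    "P n (R x) = L n (C n x) ! (q n x + 1)" "K n (R x) = K n x"
proof -
  show R: "R x = tz (jump n x) x" using cocycle_inside[OF assms] by (simp add: R_def)
  let ?j = "L n (C n x) ! (q n x + 1)"
  have j: "?j < h n (K n x)" using L_less[OF C_valid[OF x], of "q n x + 1" n] i by (simp add: inside_def)
  note y = move[OF x j] C_move[OF x j]
  show C: "C n (R x) = C n x" and P: "P n (R x) = ?j" and K: "K n (R x) = K n x"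
    using y unfolding R jump_def by auto
  show "q n (R x) = q n x + 1"
    by (rule q_unique) (use x C P K i in \<open>auto simp: inside_def\<close>)
qed

text \<open>Let \<open>m\<close> be the first level at which \<open>x\<close> is inside. At level
  \<open>m - 1\<close> the point is on top of its block, so the next floor in the order of level
  \<open>m\<close> is the first floor of the next block. This is a bottom floor at level
  \<open>m - 1\<close>, hence at all lower levels. The remaining point \<open>x0\<close> moves as
  under \<open>T\<close>.\<close>

lemma R_top:
  assumes x: "x \<in> topspace X" and i: "\<not> inside n x" shows "P n (R x) = 0"
proof (cases "\<exists>m. inside m x")
  case False
  then have "x = x0" using inside_exists x by blast
  then show ?thesis using R_x0 P_top x0_in x0_top by metis
next
  case True
  define m where "m = (LEAST n. inside n x)"
  have m: "inside m x" using True unfolding m_def by (rule LeastI_ex)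
  have notm: "\<not> inside k x" if "k < m" for k using not_less_Least that unfolding m_def by blast
  have "n < m"
  proof (rule ccontr)
    assume "\<not> n < m"
    then have "m \<le> n" by simp
    then have "inside n x" using m by (induction rule: dec_induct) (auto simp: inside_Suc[OF x])
    then show False using i by simp
  qed
  then obtain m' where m': "m = Suc m'" "n \<le> m'" by (metis Suc_leI Suc_pred gr_implies_not0 less_Suc_eq_le not_gr0)
  have top: "q m' x + 1 = h m' (K m' x)"
    using notm[of m'] m' q_spec(1)[OF x, of m'] by (simp add: inside_def)
  let ?c = "C (Suc m') x"
  have v: "valid (Suc m') ?c" using x by simp
  obtain A B where AB: "block_order m' ?c = A @ (off m' x, C m' x) # B"
    and q: "q (Suc m') x = sum_list (map (\<lambda>e. h m' (fst (snd e))) A) + q m' x"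
    using block_location[OF x] .
  let ?u = "sum_list (map (\<lambda>e. h m' (fst (snd e))) A)"
  have len: "length (map ((+) (fst e)) (L m' (snd e))) = h m' (fst (snd e))" if "e \<in> set (block_order m' ?c)" for e
    using length_L[of m' "snd e"] valid_block_order[OF v, of "fst e" "snd e"] that by simp
  have lc: "length (L m' (C m' x)) = h m' (K m' x)" using length_L[OF C_valid[OF x], of m'] by simp
  have "length (L (Suc m') ?c) = ?u + h m' (K m' x) + sum_list (map (\<lambda>e. h m' (fst (snd e))) B)"
    using len lc unfolding L.simps AB by (simp add: length_concat comp_def cong: map_cong)
  then have hl: "h (Suc m') (K (Suc m') x) = ?u + h m' (K m' x) + sum_list (map (\<lambda>e. h m' (fst (snd e))) B)"
    using length_L[OF v] by simp
  have "B \<noteq> []" using hl m q top unfolding m' inside_def by auto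
  then obtain p l B' where B: "B = (p, l) # B'" by (metis list.exhaust surj_pair)
  have pl: "(p, l) \<in> set (blocks m' (K (Suc m') x))" "valid m' l"
    using AB B set_block_order[OF v] valid_block_order[OF v, of p l] by auto
  have "L (Suc m') ?c ! (sum_list (map (\<lambda>e. h m' (fst (snd e))) (A @ [(off m' x, C m' x)])) + 0)
      = map ((+) p) (L m' l) ! 0"
    using nth_concat_block[of "A @ [(off m' x, C m' x)]" "\<lambda>e. map ((+) (fst e)) (L m' (snd e))" "\<lambda>e. h m' (fst (snd e))"
        0 "(p, l)" B'] len lc height_pos[OF pl(2)] length_L[OF pl(2)] unfolding L.simps AB B by auto
  moreover have "sum_list (map (\<lambda>e. h m' (fst (snd e))) (A @ [(off m' x, C m' x)])) + 0 = q (Suc m') x + 1"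
    using q top by simp
  ultimately have "L (Suc m') ?c ! (q (Suc m') x + 1) = p"
    using L_0[OF pl(2)] height_pos[OF pl(2)] length_L[OF pl(2)] by (simp del: L.simps)
  then have P: "P (Suc m') (R x) = p" "K (Suc m') (R x) = K (Suc m') x" using R_inside[OF x m] m' by auto
  obtain z where z: "z \<in> topspace X" "K (Suc m') z = K (Suc m') x" "P (Suc m') z = p" "P m' z = 0"
    using point_of_block[OF _ pl(1)] x by (metis imageI)
  then have P0: "P m' (R x) = 0" using refine[of "R x" z m'] P x by simp
  show ?thesis using \<open>n \<le> m'\<close>
  proof (induction rule: inc_induct)
    case base
    show ?case by (rule P0)
  next
    case (step i)
    then show ?case using bot_nested[of "R x" i] x by simp
  qed
qed

lemma all_bottom: assumes y: "y \<in> topspace X" and "\<And>n. P n y = 0" shows "y = T x0"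
proof -
  obtain x where x: "x \<in> topspace X" "y = T x" using T_surj y by blast
  have "P n x + 1 = h n (K n x)" for n
    using P_up[OF x(1), of n] P_less[OF x(1), of n] assms(2)[of n] x(2) by fastforce
  then show ?thesis using x0_unique x by simp
qed

text \<open>The preimage sits on the preceding floor of the same tower. There is no other, because a
  preimage on top at level \<open>n\<close> would be sent to a bottom floor by
  \<open>R_top\<close>.\<close>

lemma R_preimage:
  assumes y: "y \<in> topspace X" and "P n y \<noteq> 0"
  obtains z where "z \<in> topspace X" "R z = y" "inside n z"
    "\<And>x. x \<in> topspace X \<Longrightarrow> R x = y \<Longrightarrow> x = z"
proof -
  have qy: "q n y \<noteq> 0" using assms q_0_iff[OF y, of n] by simp
  have qh: "q n y < h n (K n y)" using q_spec y by simp
  define j where "j = L n (C n y) ! (q n y - 1)"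
  define z where "z = tz (int j - int (P n y)) y"
  have j: "j < h n (K n y)" using L_less[OF C_valid[OF y], of "q n y - 1" n] qh by (simp add: j_def)
  note z = move[OF y j, folded z_def] C_move[OF y j, folded z_def]
  have qz: "q n z = q n y - 1" by (rule q_unique) (use z qh j_def in auto)
  then have i: "inside n z" using qh qy z by (simp add: inside_def)
  have "jump n z = int (P n y) - int j" using qz qy z q_spec[OF y, of n] by (simp add: jump_def)
  then have Rz: "R z = y"
    using R_inside(1)[OF z(1) i] int_iter_add[OF y, of "jump n z" "int j - int (P n y)"] by (simp add: z_def)
  have "x = z" if x: "x \<in> topspace X" "R x = y" for x
  proof -
    have ix: "inside n x" using R_top[OF x(1), of n] x(2) assms(2) by auto
    note r = R_inside[OF x(1) ix]
    have "q n x = q n y - 1" "C n x = C n y" using r x by auto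
    then have "P n x = j" using q_spec(2)[OF x(1), of n] by (simp add: j_def)
    moreover have "y = tz (int (P n y) - int (P n x)) x" using r x by (simp add: jump_def)
    ultimately show "x = z" using int_iter_uminus[OF x(1), of y "int (P n y) - int (P n x)"] by (simp add: z_def)
  qed
  then show ?thesis using that z(1) Rz i by blast
qed

lemma bij_R: "bij_betw R (topspace X) (topspace X)"
proof -
  have "\<exists>!x. x \<in> topspace X \<and> R x = y" if y: "y \<in> topspace X" for y
  proof (cases "\<forall>n. P n y = 0")
    case True
    have "x = x0" if x: "x \<in> topspace X" "R x = y" for x
    proof (rule ccontr)
      assume "x \<noteq> x0"
      then obtain n where "inside n x" using inside_exists x(1) by blast
      then have "q n y \<noteq> 0" using R_inside(3)[OF x(1)] x(2) by auto
      then show False using True q_0_iff[OF y, of n] by simp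
    qed
    moreover have "R x0 = y" using R_x0 all_bottom y True by simp
    ultimately show ?thesis using x0_in by blast
  next
    case False
    then obtain n where "P n y \<noteq> 0" by blast
    then show ?thesis using R_preimage[OF y] by metis
  qed
  then have "inj_on R (topspace X)" "topspace X \<subseteq> R ` topspace X"
    using R_in unfolding inj_on_def image_def by blast+
  then show ?thesis using R_in by (auto simp: bij_betw_def)
qed

sublocale R: bijective_system X R
  by standard (rule bij_R)

abbreviation rz :: "int \<Rightarrow> 'a \<Rightarrow> 'a" where "rz \<equiv> int_iter X R"

text \<open>The level \<open>n + 1\<close> is needed to see the tags of level \<open>n\<close>.\<close>

definition nbhd :: "nat \<Rightarrow> 'a \<Rightarrow> 'a set" where
  "nbhd n x = {y \<in> topspace X. K (Suc n) y = K (Suc n) x \<and> P (Suc n) y = P (Suc n) x}"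

lemma open_nbhd: "openin X (nbhd n x)"
  unfolding nbhd_def by (rule open_atom)

lemma in_nbhd: "x \<in> topspace X \<Longrightarrow> x \<in> nbhd n x"
  by (simp add: nbhd_def)

lemma nbhd_eq:
  assumes x: "x \<in> topspace X" and y: "y \<in> nbhd n x" and "m \<le> n"
  shows "C m y = C m x" "P m y = P m x" "q m y = q m x" "K m y = K m x"
proof -
  have y': "y \<in> topspace X" using y by (simp add: nbhd_def)
  have KP: "K k y = K k x \<and> P k y = P k x" if "k \<le> Suc n" for k
    using that
  proof (induction rule: inc_induct)
    case base
    then show ?case using y by (simp add: nbhd_def)
  next
    case (step k)
    then show ?case using refine[OF y' x] by simp
  qed
  then show K: "K m y = K m x" and P: "P m y = P m x" using assms(3) by auto
  show C: "C m y = C m x" using KP[of m] KP[of "Suc m"] assms(3) by (simp add: C_def off_def)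
  show "q m y = q m x" by (rule q_unique[OF y']) (use C K P q_spec[OF x, of m] in auto)
qed

section \<open>Continuity of the cocycle off \<open>x0\<close>, and of \<open>R\<close>
  everywhere\<close>

lemma cocycle_locally_constant:
  assumes x: "x \<in> topspace X" and "inside n x" "y \<in> nbhd n x" shows "cocycle y = cocycle x"
proof -
  note e = nbhd_eq[OF x assms(3) order_refl]
  have y: "y \<in> topspace X" using assms(3) by (simp add: nbhd_def)
  have "inside n y" using e assms(2) by (simp add: inside_def)
  then show ?thesis using cocycle_inside[OF x assms(2)] cocycle_inside[OF y] e by (simp add: jump_def)
qed

lemma at_most_one_discontinuity_cocycle: "at_most_one_discontinuity X cocycle"
proof -
  have "topcontinuous_at X (discrete_topology UNIV) cocycle x" if "x \<in> topspace X" "x \<noteq> x0" for x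
  proof -
    obtain n where n: "inside n x" using inside_exists \<open>x \<noteq> x0\<close> \<open>x \<in> topspace X\<close> by blast
    show ?thesis
      by (rule topcontinuous_at_locally_constant[OF open_nbhd in_nbhd[OF that(1)]])
        (rule cocycle_locally_constant[OF that(1) n])
  qed
  then show ?thesis unfolding at_most_one_discontinuity_def by (intro exI[of _ x0]) auto
qed

text \<open>Off \<open>x0\<close> the map is locally a fixed power of \<open>T\<close>. Near
  \<open>x0\<close> the exponent may vary, but points on top at level \<open>n' + 1\<close> are sent
  to bottom floors of that level, and by \<open>bot_nested\<close> these all lie in the lowest floor
  of the tower \<open>a n'\<close>, which contains \<open>R x0\<close> and is small.\<close>

lemma continuous_R: "continuous_map X X R"
  unfolding continuous_map_eq_topcontinuous_at
proof
  fix x assume x: "x \<in> topspace X"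
  have "\<exists>W. openin X W \<and> x \<in> W \<and> (\<forall>y\<in>W. R y \<in> V)" if V: "openin X V" "R x \<in> V" for V
  proof (cases "x = x0")
    case True
    obtain n' where n': "\<forall>y\<in>topspace X. K n' y = K n' (R x) \<and> P n' y = P n' (R x) \<longrightarrow> y \<in> V"
      using basis[OF V] by blast
    let ?W = "nbhd (Suc n') x0"
    have "R y \<in> V" if y: "y \<in> ?W" for y
    proof -
      have yX: "y \<in> topspace X" using y by (simp add: nbhd_def)
      have "\<not> inside (Suc n') y" "\<not> inside (Suc n') x0"
        using nbhd_eq[OF x0_in y order_refl] not_inside_x0[of "Suc n'"] by (simp_all add: inside_def)
      then have "P (Suc n') (R y) = 0" "P (Suc n') (R x0) = 0"
        using R_top yX x0_in by blast+
      then have "P n' (R y) = P n' (R x0)" "K n' (R y) = K n' (R x0)"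
        using bot_nested[OF R_in[OF yX], of n'] bot_nested[OF R_in[OF x0_in], of n'] by auto
      then show ?thesis using n' True R_in[OF yX] by simp
    qed
    then show ?thesis using open_nbhd[of "Suc n'" x0] in_nbhd[OF x0_in, of "Suc n'"] True by blast
  next
    case False
    then obtain n where n: "inside n x" using inside_exists x by blast
    have cont: "continuous_map X X (tz (cocycle x))" by (rule continuous_int_iter[OF homeo])
    let ?W = "nbhd n x \<inter> {y \<in> topspace X. tz (cocycle x) y \<in> V}"
    have "openin X ?W" using open_nbhd openin_continuous_map_preimage[OF cont V(1)] by blast
    moreover have "x \<in> ?W" using x in_nbhd V(2) by (simp add: R_def)
    moreover have "R y \<in> V" if "y \<in> ?W" for y
      using cocycle_locally_constant[OF x n, of y] that by (simp add: R_def)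
    ultimately show ?thesis by blast
  qed
  then show "topcontinuous_at X X R x" using x R_in by (auto simp: topcontinuous_at_def)
qed

text \<open>The floor above \<open>x\<close> in the old order has a place in the new one, and the
  difference of the places is the exponent of \<open>R\<close> that produces \<open>T x\<close>. The
  value 1 is again taken as a default only at \<open>x0\<close>.\<close>

definition back_cocycle :: "'a \<Rightarrow> int" where
  "back_cocycle x = (if \<exists>n. inside n x then
     (let n = LEAST n. inside n x in int (THE i. i < h n (K n x) \<and> L n (C n x) ! i = P n x + 1) - int (q n x))
     else 1)"

lemma R_climb:
  assumes x: "x \<in> topspace X" "q n x + i < h n (K n x)"
  shows "C n (rz (int i) x) = C n x \<and> q n (rz (int i) x) = q n x + i \<and>
    rz (int i) x = tz (int (L n (C n x) ! (q n x + i)) - int (P n x)) x"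
  using assms(2)
proof (induction i)
  case 0
  then show ?case using q_spec[OF x(1), of n] by simp
next
  case (Suc i)
  let ?y = "rz (int i) x"
  have y: "?y \<in> topspace X" "rz (int (Suc i)) x = R ?y"
    using x(1) R.int_iter_Suc[of x "int i"] by (simp_all add: add.commute)
  have IH: "C n ?y = C n x" "q n ?y = q n x + i"
    "?y = tz (int (L n (C n x) ! (q n x + i)) - int (P n x)) x" using Suc by auto
  then have K: "K n ?y = K n x" by (metis fst_C)
  have i: "inside n ?y" using IH K Suc.prems by (simp add: inside_def)
  have P: "P n ?y = L n (C n x) ! (q n x + i)" using q_spec(2)[OF y(1), of n] IH by simp
  have "R ?y = tz (jump n ?y) (tz (int (L n (C n x) ! (q n x + i)) - int (P n x)) x)"
    using R_inside(1)[OF y(1) i] IH(3) by simp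
  also have "\<dots> = tz (int (L n (C n x) ! (q n x + Suc i)) - int (P n x)) x"
    using int_iter_add[OF x(1), of "jump n ?y" "int (L n (C n x) ! (q n x + i)) - int (P n x)"] P IH
    by (simp add: jump_def)
  finally show ?case using R_inside[OF y(1) i] IH y by simp
qed

text \<open>The point passes through the bottom of its tower, which is floor 0 in both orders, and
  climbs from there.\<close>

lemma R_move:
  assumes x: "x \<in> topspace X" "i < h n (K n x)"
  shows "rz (int i - int (q n x)) x = tz (int (L n (C n x) ! i) - int (P n x)) x"
    "C n (rz (int i - int (q n x)) x) = C n x" "q n (rz (int i - int (q n x)) x) = i"
proof -
  define j where "j = L n (C n x) ! 0"
  define z where "z = tz (int j - int (P n x)) x"
  have j: "j = 0" "0 < h n (K n x)" using L_0[OF C_valid[OF x(1)], of n] x(2) by (auto simp: j_def)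
  then have jl: "j < h n (K n x)" by simp
  note z = move[OF x(1) jl, folded z_def] C_move[OF x(1) jl, folded z_def]
  have qz: "q n z = 0" using q_0_iff z j by simp
  have up: "C n (rz (int k) z) = C n x \<and> q n (rz (int k) z) = k \<and>
    rz (int k) z = tz (int (L n (C n x) ! k) - int (P n x)) x" if "k < h n (K n x)" for k
  proof -
    have "tz (int (L n (C n x) ! k)) z = tz (int (L n (C n x) ! k) - int (P n x)) x"
      using int_iter_add[OF x(1), of "int (L n (C n x) ! k)" "int j - int (P n x)"] j by (simp add: z_def)
    then show ?thesis using R_climb[OF z(1), of n k] that qz z j by auto
  qed
  have "rz (int (q n x)) z = x" using up[of "q n x"] q_spec[OF x(1), of n] by simp
  then have "rz (int i) z = rz (int i - int (q n x)) x"
    using R.int_iter_add[OF z(1), of "int i - int (q n x)" "int (q n x)"] by simp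
  then show "rz (int i - int (q n x)) x = tz (int (L n (C n x) ! i) - int (P n x)) x"
    "C n (rz (int i - int (q n x)) x) = C n x" "q n (rz (int i - int (q n x)) x) = i"
    using up[OF x(2)] by auto
qed

lemma T_back_cocycle: assumes x: "x \<in> topspace X" shows "T x = rz (back_cocycle x) x"
proof (cases "\<exists>n. inside n x")
  case False
  then have "x = x0" using inside_exists x by blast
  then show ?thesis using False R_x0 by (simp add: back_cocycle_def)
next
  case True
  define n where "n = (LEAST n. inside n x)"
  have n: "inside n x" using True unfolding n_def by (rule LeastI_ex)
  define i where "i = (THE i. i < h n (K n x) \<and> L n (C n x) ! i = P n x + 1)"
  have P: "P n x + 1 < h n (K n x)" using not_inside_iff[OF x, of n] n P_less[OF x, of n] by simp
  then have "P n x + 1 \<in> set (L n (C n x))" using set_L[OF C_valid[OF x], of n] by simp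
  then obtain k where k: "k < h n (K n x)" "L n (C n x) ! k = P n x + 1"
    using length_L[OF C_valid[OF x], of n] by (auto simp: in_set_conv_nth)
  then have "i = k" unfolding i_def using L_inj[OF C_valid[OF x], of _ n k]
    by (intro the_equality) (auto)
  then have "rz (int i - int (q n x)) x = tz 1 x" using R_move[OF x k(1)] k by simp
  moreover have "back_cocycle x = int i - int (q n x)"
    using True by (simp add: back_cocycle_def Let_def i_def n_def)
  ultimately show ?thesis by simp
qed

lemma at_most_one_discontinuity_back_cocycle: "at_most_one_discontinuity X back_cocycle"
proof -
  have "topcontinuous_at X (discrete_topology UNIV) back_cocycle x" if x: "x \<in> topspace X" "x \<noteq> x0" for x
  proof (rule topcontinuous_at_locally_constant[OF open_nbhd in_nbhd[OF x(1)]])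
    define n where "n = (LEAST n. inside n x)"
    have ex: "\<exists>n. inside n x" using inside_exists x by blast
    then have n: "inside n x" unfolding n_def by (rule LeastI_ex)
    fix y assume y: "y \<in> nbhd n x"
    note e = nbhd_eq[OF x(1) y]
    have ie: "inside m y = inside m x" if "m \<le> n" for m using e[OF that] by (simp add: inside_def)
    \<comment> \<open>Unlike for \<open>cocycle\<close>, independence of the level has not been
      established for this formula, so the least level itself is shown to be constant on
      \<open>nbhd n x\<close>.\<close>
    have "(LEAST n. inside n y) = n"
    proof (rule Least_equality)
      show "inside n y" using n ie by simp
      fix m assume m: "inside m y"
      show "n \<le> m"
      proof (rule ccontr)
        assume "\<not> n \<le> m"
        then have "inside m x" using m ie[of m] by simp
        then have "n \<le> m" unfolding n_def by (rule Least_le)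
        then show False using \<open>\<not> n \<le> m\<close> by simp
      qed
    qed
    moreover have "\<exists>n. inside n y" using n ie by blast
    ultimately show "back_cocycle y = back_cocycle x"
      using ex e[OF order_refl] by (simp add: back_cocycle_def flip: n_def)
  qed
  then show ?thesis unfolding at_most_one_discontinuity_def by (intro exI[of _ x0]) auto
qed

lemma orbit_R: assumes x: "x \<in> topspace X" shows "orbit_of X R x = orbit_of X T x"
proof
  show "orbit_of X R x \<subseteq> orbit_of X T x"
    by (rule orbit_of_subset[OF R.bijective_system_axioms _ x]) (auto simp: orbit_of_def R_def)
  show "orbit_of X T x \<subseteq> orbit_of X R x"
    by (rule R.orbit_of_subset[OF bijective_system_axioms _ x])
      (use T_back_cocycle in \<open>auto simp: orbit_of_def\<close>)
qed

end

section \<open>Symbolic coding and complexity\<close>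

context tower_system
begin

text \<open>The tower \<open>l\<close> is entered at least twice during one climb of
  \<open>k\<close>, and two entries are at least \<open>h n l\<close> floors apart.\<close>

lemma height_less:
  assumes k: "k \<in> K (Suc n) ` topspace X" and l: "l \<in> K n ` topspace X"
  shows "h n l < h (Suc n) k"
proof -
  obtain w where "w \<in> topspace X" "K (Suc n) w = k" using k by auto
  then have "0 < h (Suc n) k" using P_less[of w "Suc n"] by simp
  then obtain x where x: "x \<in> topspace X" "K (Suc n) x = k" "P (Suc n) x = 0" using reach[OF k] by blast
  obtain y where y: "y \<in> topspace X" "K n y = l" using l by auto
  define S where "S = {i. i < h (Suc n) (K (Suc n) x) \<and> K n (tz (int i) x) = K n y \<and> P n (tz (int i) x) = 0}"
  have "10 \<le> card S" using many[OF x(1) y(1) x(3)] by (simp add: S_def)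
  then have "\<not> (\<exists>i. S \<subseteq> {i})" using card_mono[of "{i}" S for i] by fastforce
  then obtain i j where ij: "i \<in> S" "j \<in> S" "i < j" by (metis linorder_neqE_nat singletonI subsetI)
  let ?z = "tz (int i) x"
  have z: "?z \<in> topspace X" "K n ?z = l" "P n ?z = 0" using ij x y by (auto simp: S_def)
  have "tz (int (j - i)) ?z = tz (int j) x"
    using int_iter_add[OF x(1), of "int (j - i)" "int i"] ij by (simp add: of_nat_diff)
  then have "\<not> j - i < h n l" using climb_up[OF z(1), of n "j - i"] z ij by (auto simp: S_def)
  moreover have "j < h (Suc n) k" using ij x by (auto simp: S_def)
  ultimately show ?thesis by linarith
qed

lemma height_ge: "k \<in> K n ` topspace X \<Longrightarrow> n \<le> h n k"
proof (induction n arbitrary: k)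
  case (Suc n)
  have "n \<le> h n (K n x0)" by (rule Suc.IH) (use x0_in in blast)
  also have "\<dots> < h (Suc n) k" using height_less[OF Suc.prems] x0_in by blast
  finally show ?case by simp
qed simp

text \<open>A letter records the tag at level 0 besides the tower and the place in it, because the
  recovery of level 1 starts from these tags.\<close>

definition code :: "'a \<Rightarrow> nat" where
  "code x = prod_encode (prod_encode (C 0 x), q 0 x)"

definition itin :: "'a \<Rightarrow> int \<Rightarrow> nat" where
  "itin x = (\<lambda>i. code (rz i x))"

abbreviation alphabet :: "nat set" where "alphabet \<equiv> code ` topspace X"

abbreviation Y :: "(int \<Rightarrow> nat) set" where "Y \<equiv> itin ` topspace X"

abbreviation TY :: "(int \<Rightarrow> nat) topology" where "TY \<equiv> subtopology (full_shift alphabet) Y"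

lemma finite_alphabet: "finite alphabet"
proof (rule finite_subset)
  show "alphabet \<subseteq> (\<lambda>(k, t, i). prod_encode (prod_encode (k, t), i)) ` (SIGMA k:{..D}. {..2} \<times> {..<h 0 k})"
  proof
    fix v assume "v \<in> alphabet"
    then obtain x where x: "x \<in> topspace X" "v = code x" by blast
    have "v = (\<lambda>(k, t, i). prod_encode (prod_encode (k, t), i)) (K 0 x, snd (C 0 x), q 0 x)"
      using x by (simp add: code_def C_def)
    moreover have "(K 0 x, snd (C 0 x), q 0 x) \<in> (SIGMA k:{..D}. {..2} \<times> {..<h 0 k})"
      using K_le[OF x(1)] valid_le[OF C_valid[OF x(1)], of 0] q_spec(1)[OF x(1), of 0] by simp
    ultimately show "v \<in> (\<lambda>(k, t, i). prod_encode (prod_encode (k, t), i)) ` (SIGMA k:{..D}. {..2} \<times> {..<h 0 k})"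
      by (rule image_eqI)
  qed
qed simp

lemma code_inj:
  assumes "code x = code y" shows "C 0 x = C 0 y \<and> q 0 x = q 0 y"
  using assms by (auto simp: code_def)

lemma itin_R: "x \<in> topspace X \<Longrightarrow> itin (R x) = shift (itin x)"
  using R.int_iter_add[of x _ 1] by (simp add: itin_def shift_def)

text \<open>The height at level n + 1 is the block offset plus the height in the block, and tag 1
  marks the offset 0.\<close>

lemma tag_1_iff: "x \<in> topspace X \<Longrightarrow> q (Suc n) x = 0 \<longleftrightarrow> snd (C n x) = 1 \<and> q n x = 0"
  using q_0_iff[of x n] q_0_iff[of x "Suc n"] P_Suc[of x n] by (auto simp: C_def tag_def)

lemma bottom_height_pos: "0 < h n (a n)"
proof -
  have "P (Suc n) (T x0) = 0" using P_top[OF x0_in x0_top] .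
  then have "K n (T x0) = a n" using bot_nested T_in x0_in by blast
  then show ?thesis using P_less[of "T x0" n] T_in x0_in by auto
qed

text \<open>Since the towers of the letters \<open>(a n, _)\<close> all have the same height, the first visit of the
  tag 2 after entering the tower \<open>c\<close> of level \<open>n + 1\<close> reveals \<open>c\<close>.\<close>

lemma tag_2_time:
  assumes z: "z \<in> topspace X" "q (Suc n) z = 0"
  defines "t \<equiv> (1 + enc (C (Suc n) z)) * h n (a n)"
  shows "i < t \<Longrightarrow> snd (C n (rz (int i) z)) \<noteq> 2" and "snd (C n (rz (int t) z)) = 2"
proof -
  define c where "c = C (Suc n) z"
  define g where "g = (\<lambda>e :: nat \<times> nat \<times> nat. h n (fst (snd e)))"
  define u where "u = (\<lambda>es. sum_list (map g es))"
  have v: "valid (Suc n) c" using z by (simp add: c_def)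
  obtain Zs s rest where ord: "block_order n c = (0, (a n, 1)) # Zs @ (s, (a n, 2)) # rest"
    "length Zs = enc c" "\<forall>z\<in>set Zs. snd z = (a n, 0)"
    using block_order_spec[OF v] unfolding reordered_def by blast
  define pre where "pre = (0, (a n, 1::nat)) # Zs"
  have pre: "block_order n c = pre @ (s, (a n, 2)) # rest" using ord by (simp add: pre_def)
  have "sum_list (map g Zs) = length Zs * h n (a n)" using ord(3) by (induction Zs) (auto simp: g_def)
  then have u_pre: "u pre = t" unfolding u_def pre_def t_def using ord(2) by (simp add: g_def c_def)
  have "length (map ((+) (fst e)) (L n (snd e))) = g e" if "e \<in> set (block_order n c)" for e
    using length_L[of n "snd e"] valid_block_order[OF v, of "fst e" "snd e"] that by (simp add: g_def)
  then have "length (L (Suc n) c) = u (block_order n c)"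
    by (simp add: length_concat comp_def u_def cong: map_cong)
  then have "h (Suc n) (fst c) = t + h n (a n) + u rest"
    using length_L[OF v] u_pre unfolding pre by (simp add: u_def g_def)
  then have tH: "t < h (Suc n) (K (Suc n) z)" using bottom_height_pos[of n] by (simp add: c_def)
  have main: "(i < t \<longrightarrow> snd (C n (rz (int i) z)) \<noteq> 2) \<and> (i = t \<longrightarrow> snd (C n (rz (int i) z)) = 2)"
    if i: "i \<le> t" for i
  proof -
    define x where "x = rz (int i) z"
    have x: "x \<in> topspace X" "C (Suc n) x = c" "q (Suc n) x = i"
      using R_climb[OF z(1), of "Suc n" i] i tH z by (auto simp: c_def x_def)
    obtain A B where AB: "block_order n c = A @ (off n x, C n x) # B" "i = u A + q n x"
      using block_location[OF x(1), of n] x unfolding u_def g_def by metis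
    have qx: "q n x < h n (K n x)" using q_spec(1)[OF x(1)] .
    have "A @ (off n x, C n x) # B = pre @ (s, (a n, 2)) # rest" using AB(1) pre by simp
    \<comment> \<open>The block of \<open>x\<close> lies in \<open>pre\<close>, where no tag is 2,
      or is the marked block, or comes later; the last is excluded by
      \<open>i \<le> t\<close>.\<close>
    then consider us where "A = pre @ us" "us @ (off n x, C n x) # B = (s, (a n, 2)) # rest"
      | us where "A @ us = pre" "(off n x, C n x) # B = us @ (s, (a n, 2)) # rest"
      by (auto simp: append_eq_append_conv2)
    then show ?thesis
    proof cases
      case 1
      show ?thesis
      proof (cases us)
        case Nil
        then have "C n x = (a n, 2)" using 1 by simp
        moreover have "\<not> i < t" using 1 Nil AB(2) u_pre by simp
        ultimately show ?thesis by (auto simp: x_def)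
      next
        case (Cons e es)
        then have "u A = u pre + h n (a n) + u es" using 1 by (simp add: u_def g_def)
        then show ?thesis using AB(2) u_pre i bottom_height_pos[of n] by simp
      qed
    next
      case 2
      show ?thesis
      proof (cases us)
        case Nil
        then have "C n x = (a n, 2)" using 2 by simp
        moreover have "\<not> i < t" using 2 Nil AB(2) u_pre by simp
        ultimately show ?thesis by (auto simp: x_def)
      next
        case (Cons e es)
        then have e: "e = (off n x, C n x)" "pre = A @ (off n x, C n x) # es" using 2 by auto
        then have "(off n x, C n x) \<in> set pre" by simp
        then have "snd (C n x) \<noteq> 2" using ord(3) by (auto simp: pre_def)
        moreover have "u pre = u A + h n (K n x) + u es" unfolding e(2) by (simp add: u_def g_def)
        then have "i < t" using AB(2) u_pre qx by simp
        ultimately show ?thesis by (simp add: x_def)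
      qed
    qed
  qed
  show "i < t \<Longrightarrow> snd (C n (rz (int i) z)) \<noteq> 2" using main[of i] by simp
  show "snd (C n (rz (int t) z)) = 2" using main[of t] by simp
qed

text \<open>Going back by the position \<open>Q\<close> leads to the start \<open>z\<close> of the
  tower of level n + 1. By induction the orbits of \<open>z\<close> and \<open>z'\<close> show the
  same tags at level n, so tag 1 makes \<open>z'\<close> a start too, and equal waiting times for
  tag 2 give equal names. Climbing \<open>Q\<close> steps returns to time \<open>i\<close>. The
  statement is for all times because this argument looks at other times of the orbit.\<close>

lemma itin_determines:
  assumes x: "x \<in> topspace X" and y: "y \<in> topspace X" and eq: "itin x = itin y"
  shows "C n (rz i x) = C n (rz i y) \<and> q n (rz i x) = q n (rz i y)"
proof (induction n arbitrary: i)
  case 0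
  have "code (rz i x) = code (rz i y)" using fun_cong[OF eq, of i] by (simp add: itin_def)
  then show ?case by (rule code_inj)
next
  case (Suc n)
  define Q where "Q = q (Suc n) (rz i x)"
  define z where "z = rz (i - int Q) x"
  define z' where "z' = rz (i - int Q) y"
  have X: "rz i x \<in> topspace X" "z \<in> topspace X" "z' \<in> topspace X" using x y by (auto simp: z_def z'_def)
  have Q: "Q < h (Suc n) (K (Suc n) (rz i x))" unfolding Q_def using q_spec(1) X by blast
  then have H0: "0 < h (Suc n) (K (Suc n) (rz i x))" by simp
  have "rz (int 0 - int Q) (rz i x) = z"
    using R.int_iter_add[OF x, of "int 0 - int Q" i] by (simp add: z_def)
  then have z: "C (Suc n) z = C (Suc n) (rz i x)" "q (Suc n) z = 0"
    using R_move[OF X(1) H0] by (simp_all add: Q_def)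
  have same: "C n (rz j z) = C n (rz j z')" for j
    using Suc.IH[of "j + (i - int Q)"] R.int_iter_add[OF x, of j "i - int Q"]
      R.int_iter_add[OF y, of j "i - int Q"] by (simp add: z_def z'_def)
  have "C n z = C n z'" "q n z = q n z'"
    using Suc.IH[of "i - int Q"] by (simp_all add: z_def z'_def)
  then have z': "q (Suc n) z' = 0" using tag_1_iff[OF X(2), of n] tag_1_iff[OF X(3), of n] z by simp
  let ?t = "\<lambda>z. (1 + enc (C (Suc n) z)) * h n (a n)"
  have "?t z = ?t z'"
    using tag_2_time[OF X(2) z(2)] tag_2_time[OF X(3) z'] same by (metis linorder_neqE_nat)
  then have "enc (C (Suc n) z) = enc (C (Suc n) z')" using bottom_height_pos[of n] by simp
  then have c: "C (Suc n) z = C (Suc n) z'" using enc_inj C_valid X by blast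
  then have "K (Suc n) z' = K (Suc n) (rz i x)" using z by (metis fst_C)
  then have "C (Suc n) (rz (int Q) z') = C (Suc n) z'" "q (Suc n) (rz (int Q) z') = Q"
    using R_climb[OF X(3), of "Suc n" Q] z' Q by auto
  moreover have "rz (int Q) z' = rz i y"
    using R.int_iter_add[OF y, of "int Q" "i - int Q"] by (simp add: z'_def)
  ultimately show ?case using c z by (simp add: Q_def)
qed

lemma inj_itin: "inj_on itin (topspace X)"
proof
  fix x y assume x: "x \<in> topspace X" and y: "y \<in> topspace X" and eq: "itin x = itin y"
  have CQ: "C n x = C n y \<and> q n x = q n y" for n
    using itin_determines[OF x y eq, of n 0] by simp
  have KP: "K n x = K n y" "P n x = P n y" for n
    using CQ[of n] q_spec(2)[OF x, of n] q_spec(2)[OF y, of n] by (metis fst_C, simp)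
  show "x = y"
  proof (rule ccontr)
    assume "x \<noteq> y"
    then obtain U where U: "openin X U" "x \<in> U" "y \<notin> U"
      using hausdorff x y unfolding Hausdorff_space_def disjnt_def by blast
    then show False using basis[OF U(1,2)] KP y by metis
  qed
qed

section \<open>The coding as a homeomorphism onto a subshift\<close>

lemma topspace_full_shift: "topspace (full_shift S) = {y. range y \<subseteq> S}"
  by (auto simp: full_shift_def PiE_def Pi_def)

lemma Y_subset: "Y \<subseteq> topspace (full_shift alphabet)"
  unfolding topspace_full_shift by (auto simp: itin_def)

lemma topspace_TY: "topspace TY = Y"
  by (metis Y_subset inf.absorb2 topspace_subtopology)

lemma continuous_code: "continuous_map X (discrete_topology alphabet) code"
  unfolding continuous_map_eq_topcontinuous_at
proof
  fix x assume x: "x \<in> topspace X"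
  have "code y = code x" if "y \<in> nbhd 0 x" for y
    using nbhd_eq[OF x that, of 0] by (simp add: code_def)
  then have "topcontinuous_at X (discrete_topology UNIV) code x"
    by (intro topcontinuous_at_locally_constant[OF open_nbhd in_nbhd[OF x]])
  then show "topcontinuous_at X (discrete_topology alphabet) code x"
    unfolding topcontinuous_at_def by auto
qed

lemma homeomorphic_R: "homeomorphic_map X X R"
  using bij_R T1_Spaces.continuous_imp_closed_map[OF continuous_R compact hausdorff] continuous_R
  by (intro bijective_closed_imp_homeomorphic_map) (auto simp: bij_betw_def)

lemma Hausdorff_full_shift: "Hausdorff_space (full_shift S)"
  unfolding full_shift_def by (simp add: Hausdorff_space_product_topology)

lemma continuous_itin: "continuous_map X (full_shift alphabet) itin"
  unfolding full_shift_def continuous_map_componentwise_UNIV itin_def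
  using continuous_map_compose[OF R.continuous_int_iter[OF homeomorphic_R] continuous_code]
  by (simp add: comp_def)

lemma homeomorphic_itin: "homeomorphic_map X TY itin"
proof (rule bijective_closed_imp_homeomorphic_map)
  show c: "continuous_map X TY itin"
    using continuous_itin by (simp add: continuous_map_in_subtopology)
  show "closed_map X TY itin"
    by (rule T1_Spaces.continuous_imp_closed_map[OF c compact])
      (rule Hausdorff_space_subtopology[OF Hausdorff_full_shift])
  show "itin ` topspace X = topspace TY" using topspace_TY by simp
qed (rule inj_itin)

lemma shift_Y: "shift ` Y = Y"
proof -
  have "shift ` Y = itin ` R ` topspace X" using itin_R by (auto simp: image_image)
  then show ?thesis using bij_R by (simp add: bij_betw_def)
qed

lemma subshift_Y: "is_subshift alphabet Y"
proof -
  have "compactin (full_shift alphabet) Y"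
    using image_compactin[OF _ continuous_itin] compact by (simp add: compact_space_def)
  then have "closedin (full_shift alphabet) Y"
    by (rule compactin_imp_closedin[OF Hausdorff_full_shift])
  then show ?thesis using finite_alphabet shift_Y by (simp add: is_subshift_def)
qed

lemma bij_shift: "bij_betw shift (topspace TY) (topspace TY)"
proof -
  have "inj shift" unfolding inj_def shift_def by (metis diff_add_cancel ext)
  then show ?thesis using shift_Y topspace_TY by (auto simp: bij_betw_def inj_on_def inj_def)
qed

sublocale S: bijective_system TY shift
  by standard (rule bij_shift)

lemma itin_rz: "x \<in> topspace X \<Longrightarrow> itin (rz i x) = int_iter TY shift i (itin x)"
  using R.int_iter_conj[OF S.bijective_system_axioms, of itin x i] topspace_TY itin_R by auto

lemma orbit_itin_R: "x \<in> topspace X \<Longrightarrow> itin ` orbit_of X R x = orbit_of TY shift (itin x)"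
  unfolding orbit_of_def image_image using itin_rz by simp

lemma orbit_itin: "x \<in> topspace X \<Longrightarrow> itin ` orbit_of X T x = orbit_of TY shift (itin x)"
  by (metis orbit_R orbit_itin_R)

lemma homeomorphic_shift: "homeomorphic_map TY TY shift"
proof (rule bijective_closed_imp_homeomorphic_map)
  have "continuous_map TY (full_shift alphabet) (\<lambda>y. shift y)"
    unfolding full_shift_def continuous_map_componentwise_UNIV shift_def
    by (intro allI continuous_map_from_subtopology continuous_map_product_projection) simp
  then show c: "continuous_map TY TY shift"
    using shift_Y topspace_TY by (auto simp: continuous_map_in_subtopology)
  have "compact_space TY"
    using homeomorphic_compact_space homeomorphic_map_imp_homeomorphic_space[OF homeomorphic_itin] compact
    by blast
  then show "closed_map TY TY shift"
    by (rule T1_Spaces.continuous_imp_closed_map[OF c])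
      (rule Hausdorff_space_subtopology[OF Hausdorff_full_shift])
qed (use bij_shift in \<open>auto simp: bij_betw_def\<close>)

text \<open>Since \<open>R\<close> has the orbits of \<open>T\<close>, density of orbits is simply
  carried over by \<open>itin\<close>.\<close>

lemma minimal_Y:
  assumes "minimal_cantor_system X T" shows "minimal_cantor_system TY shift"
  unfolding minimal_cantor_system_def
proof (intro conjI ballI)
  have "X homeomorphic_space TY"
    using homeomorphic_map_imp_homeomorphic_space[OF homeomorphic_itin] .
  then show "cantor_set TY"
    using assms unfolding minimal_cantor_system_def cantor_set_def
    by (meson homeomorphic_space_sym homeomorphic_space_trans)
  show "homeomorphic_map TY TY shift" by (rule homeomorphic_shift)
  fix y assume "y \<in> topspace TY"
  then obtain x where x: "x \<in> topspace X" "y = itin x" using topspace_TY by auto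
  have "orbit_of X T x \<subseteq> topspace X" using x by (auto simp: orbit_of_def)
  then have "TY closure_of (itin ` orbit_of X T x) = itin ` (X closure_of (orbit_of X T x))"
    by (rule homeomorphic_map_closure_of[OF homeomorphic_itin])
  also have "X closure_of (orbit_of X T x) = topspace X"
    using assms x by (simp add: minimal_cantor_system_def)
  finally show "TY closure_of (orbit_of TY shift y) = topspace TY"
    using orbit_itin[OF x(1)] x(2) topspace_TY by simp
qed

text \<open>Here \<open>back_cocycle\<close> is the \<alpha> and \<open>cocycle\<close> the \<beta>
  of the definition.\<close>

lemma strongly_orbit_equivalent_Y: "strongly_orbit_equivalent X T TY shift"
proof -
  have "itin (T x) = int_iter TY shift (back_cocycle x) (itin x)" if "x \<in> topspace X" for x
    using T_back_cocycle[OF that] itin_rz[OF that] by metis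
  moreover have "itin (tz (cocycle x) x) = shift (itin x)" if "x \<in> topspace X" for x
    using itin_R[OF that] by (simp add: R_def)
  ultimately show ?thesis
    unfolding strongly_orbit_equivalent_def
    using homeomorphic_itin orbit_itin at_most_one_discontinuity_cocycle
      at_most_one_discontinuity_back_cocycle by blast
qed

text \<open>The letters met while climbing the tower named \<open>c\<close> in the new order. Block
  offsets are dropped, so equal names give equal words and a run of names becomes a power.\<close>

primrec w :: "nat \<Rightarrow> nat \<times> nat \<Rightarrow> nat list" where
  "w 0 c = map (\<lambda>i. prod_encode (prod_encode c, i)) [0..<h 0 (fst c)]"
| "w (Suc n) c = concat (map (w n) (map snd (block_order n c)))"

lemma length_w: "valid n c \<Longrightarrow> length (w n c) = h n (fst c)"
proof (induction n arbitrary: c)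
  case (Suc n)
  have "length (w n (snd e)) = length (map ((+) (fst e)) (L n (snd e)))" if "e \<in> set (block_order n c)" for e
    using Suc.IH[of "snd e"] length_L[of n "snd e"] valid_block_order[OF Suc.prems, of "fst e" "snd e"] that by simp
  then have "length (w (Suc n) c) = length (L (Suc n) c)"
    by (simp add: length_concat comp_def cong: map_cong)
  then show ?case using length_L[OF Suc.prems] by simp
qed simp

lemma code_eq: "x \<in> topspace X \<Longrightarrow> code x = w n (C n x) ! q n x"
proof (induction n)
  case 0
  then show ?case using q_spec(1)[of x 0] by (simp add: code_def)
next
  case (Suc n)
  let ?c = "C (Suc n) x"
  obtain A B where AB: "block_order n ?c = A @ (off n x, C n x) # B"
    "q (Suc n) x = sum_list (map (\<lambda>e. h n (fst (snd e))) A) + q n x"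
    using block_location[OF Suc.prems] .
  have v: "valid (Suc n) ?c" using Suc.prems by simp
  have len: "length (w n (snd e)) = h n (fst (snd e))" if "e \<in> set (block_order n ?c)" for e
    using length_w[of n "snd e"] valid_block_order[OF v, of "fst e" "snd e"] that by simp
  have "concat (map (\<lambda>e. w n (snd e)) (A @ (off n x, C n x) # B)) !
      (sum_list (map (\<lambda>e. h n (fst (snd e))) A) + q n x) = w n (snd (off n x, C n x)) ! q n x"
    by (rule nth_concat_block) (use len AB(1) q_spec(1)[OF Suc.prems, of n]
      length_w[OF C_valid[OF Suc.prems], of n] in auto)
  then show ?case using Suc AB by (simp add: comp_def)
qed

lemma code_climb:
  assumes "x \<in> topspace X" "q n x + i < h n (K n x)"
  shows "code (rz (int i) x) = w n (C n x) ! (q n x + i)"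
proof -
  have "C n (rz (int i) x) = C n x" "q n (rz (int i) x) = q n x + i" using R_climb[OF assms] by auto
  then show ?thesis using code_eq[of "rz (int i) x" n] assms(1) by simp
qed

lemma words_subset:
  assumes N: "\<And>k. k \<in> K n ` topspace X \<Longrightarrow> N \<le> h n k"
  shows "words Y N \<subseteq> (\<Union>(c, c') \<in> Collect (valid n) \<times> Collect (valid n). block_factors N (w n c @ w n c'))"
proof
  fix u assume "u \<in> words Y N"
  then obtain x0 i where x0: "x0 \<in> topspace X" "u = map (\<lambda>j. itin x0 (i + int j)) [0..<N]"
    by (auto simp: words_def)
  define x where "x = rz i x0"
  have x: "x \<in> topspace X" using x0 by (simp add: x_def)
  have u: "u = map (\<lambda>j. code (rz (int j) x)) [0..<N]"
    using x0 by (simp add: itin_def x_def R.int_iter_add[OF x0(1), symmetric] add.commute)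
  \<comment> \<open>The number of steps from \<open>x\<close> to the bottom of the next
    tower.\<close>
  define l where "l = h n (K n x) - q n x"
  have qx: "q n x < h n (K n x)" using q_spec(1)[OF x] .
  define y where "y = rz (int (l - 1)) x"
  have y: "y \<in> topspace X" "q n y + 1 = h n (K n y)"
    using R_climb[OF x, of n "l - 1"] qx x by (auto simp: y_def l_def) (metis fst_C Suc_pred add.commute add_Suc_right le_add_diff_inverse less_imp_le zero_less_diff)
  have z: "R y \<in> topspace X" "q n (R y) = 0"
    using R_top[OF y(1), of n] y q_0_iff[of "R y" n] by (simp_all add: inside_def)
  have Ry: "R y = rz (int l) x"
    using R.int_iter_Suc[OF x, of "int (l - 1)"] qx by (simp add: y_def l_def)
  let ?v = "w n (C n x) @ w n (C n (R y))"
  have lw: "length (w n (C n x)) = h n (K n x)" "length (w n (C n (R y))) = h n (K n (R y))"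
    using length_w C_valid x z by simp_all
  have Nz: "N \<le> h n (K n (R y))" using N z by simp
  have "u = take N (drop (q n x) ?v)"
  proof (rule nth_equalityI)
    show "length u = length (take N (drop (q n x) ?v))" using u lw qx Nz by simp
    fix j assume "j < length u"
    then have j: "j < N" by (simp add: u)
    show "u ! j = take N (drop (q n x) ?v) ! j"
    proof (cases "j < l")
      case True
      then have "code (rz (int j) x) = w n (C n x) ! (q n x + j)"
        using code_climb[OF x] by (simp add: l_def)
      then show ?thesis using j u lw True qx Nz by (simp add: nth_append l_def)
    next
      case False
      then have "rz (int j) x = rz (int (j - l)) (R y)"
        using Ry R.int_iter_add[OF x, of "int (j - l)" "int l"] by (simp add: of_nat_diff)
      moreover have "code (rz (int (j - l)) (R y)) = w n (C n (R y)) ! (j - l)"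
        using code_climb[OF z(1), of n "j - l"] z(2) j Nz by simp
      moreover have "q n x + j - h n (K n x) = j - l" "\<not> q n x + j < h n (K n x)"
        using False qx by (auto simp: l_def)
      moreover have "take N (drop (q n x) ?v) ! j = ?v ! (q n x + j)"
        using j lw qx Nz by (subst nth_take, simp, subst nth_drop) simp_all
      moreover have "?v ! (q n x + j) = w n (C n (R y)) ! (q n x + j - h n (K n x))"
        using calculation(4) lw by (simp add: nth_append_right)
      ultimately show ?thesis using j u by simp
    qed
  qed
  moreover have "q n x + N \<le> length ?v" using lw qx Nz by simp
  ultimately have "u \<in> block_factors N ?v" unfolding block_factors_def by blast
  moreover have "valid n (C n x)" "valid n (C n (R y))" using x z by simp_all
  ultimately show "u \<in> (\<Union>(c, c') \<in> Collect (valid n) \<times> Collect (valid n). block_factors N (w n c @ w n c'))"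
    by blast
qed

lemma card_valid: "finite (Collect (valid n))" "card (Collect (valid n)) \<le> 3 * (D + 1)"
proof -
  have sub: "Collect (valid n) \<subseteq> {..D} \<times> {..2}" using valid_le by force
  then show "finite (Collect (valid n))" by (rule finite_subset) simp
  have "card (Collect (valid n)) \<le> card ({..D} \<times> {..2::nat})" by (rule card_mono) (use sub in simp_all)
  then show "card (Collect (valid n)) \<le> 3 * (D + 1)" by (simp add: card_cartesian_product)
qed

text \<open>The number of runs is bounded independently of the level and of the number of blocks, so
  one level up multiplies the bound by a constant and adds a multiple of \<open>N\<close>.\<close>

lemma card_factors_w_Suc:
  assumes "1 \<le> N" "\<And>c. valid n c \<Longrightarrow> card (block_factors N (w n c)) \<le> F" "valid (Suc n) c"
  shows "card (block_factors N (w (Suc n) c)) \<le> (D + 6) * (F + 2 * N)"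
  unfolding w.simps
proof (rule card_block_factors_has_runs[OF assms(1)])
  show "has_runs (D + 6) (map snd (block_order n c))"
    using block_order_spec[OF assms(3)] by (simp add: reordered_def)
  show "card (block_factors N (w n v)) \<le> F" if "v \<in> set (map snd (block_order n c))" for v
    using valid_block_order[OF assms(3)] that assms(2) by force
qed

text \<open>If \<open>m + 1\<close> is the largest level with a tower of height less than \<open>N\<close>, then all towers of
  level \<open>m\<close> are shorter than \<open>N\<close>, and every word of length \<open>N\<close> is seen across two towers of level
  \<open>m + 2\<close>.\<close>

lemma complexity_bound:
  obtains B where "\<And>N. complexity Y N \<le> B * N \<or> N = 0"
proof -
  \<comment> \<open>The sum of heights bounds the factors when \<open>m = 0\<close>; the summand 1
    covers the other case, where the words of level \<open>m\<close> are shorter than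
    \<open>N\<close>.\<close>
  define H where "H = (\<Sum>k\<le>D. h 0 k) + 1"
  define r where "r = D + 6"
  \<comment> \<open>The first two factors count pairs of names. The last one is twice the bound for
    a word of level \<open>m + 2\<close>, plus one seam, after \<open>N\<close> has been taken out
    by \<open>H + 2 * N \<le> (H + 2) * N\<close>.\<close>
  define B where "B = (3 * (D + 1)) * (3 * (D + 1)) * (2 * (r * (r * (H + 2) + 2)) + 1)"
  have "complexity Y N \<le> B * N" if "N \<noteq> 0" for N
  proof -
    have N: "1 \<le> N" using that by simp
    define tall where "tall = (\<lambda>n. \<forall>k\<in>K n ` topspace X. N \<le> h n k)"
    have "tall N" using height_ge by (simp add: tall_def)
    define M where "M = (LEAST n. tall n)"
    have M: "tall M" unfolding M_def using \<open>tall N\<close> by (rule LeastI)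
    \<comment> \<open>Truncated subtraction: \<open>m\<close> is 0 whenever
      \<open>M \<le> 2\<close>.\<close>
    define m where "m = M - 2"
    have "tall (Suc n)" if "tall n" for n
    proof -
      have "N \<le> h n (K n x0)" using that x0_in by (simp add: tall_def)
      moreover have "h n (K n x0) < h (Suc n) k" if "k \<in> K (Suc n) ` topspace X" for k
        using height_less[OF that] x0_in by blast
      ultimately show ?thesis by (fastforce simp: tall_def)
    qed
    moreover have "M \<le> Suc (Suc m)" by (simp add: m_def)
    ultimately have tall: "tall (Suc (Suc m))" using M by (metis dec_induct)
    have F0: "card (block_factors N (w m c)) \<le> H" if c: "valid m c" for c
    proof (cases "M \<le> 2")
      case True
      then have "m = 0" by (simp add: m_def)
      then have "length (w m c) = h 0 (fst c)" using length_w[OF c] by simp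
      moreover have "h 0 (fst c) \<le> (\<Sum>k\<le>D. h 0 k)"
        using valid_le[OF c] by (intro member_le_sum) auto
      ultimately show ?thesis using card_block_factors_le_length[OF N, of "w m c"] by (simp add: H_def)
    next
      case False
      then have "Suc m < M" by (simp add: m_def)
      then have "\<not> tall (Suc m)" unfolding M_def by (rule not_less_Least)
      then obtain k where k: "k \<in> K (Suc m) ` topspace X" "h (Suc m) k < N"
        unfolding tall_def using not_le by blast
      have "length (w m c) < N"
        using height_less[OF k(1), of "fst c"] c k(2) length_w[OF c] by (simp add: valid_def)
      then show ?thesis using card_block_factors_short[of "w m c" N] by (simp add: H_def)
    qed
    \<comment> \<open>Two steps lead from level \<open>m\<close> to a level where
      \<open>words_subset\<close> applies. Their number does not depend on \<open>N\<close>, hence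
      neither does the constant.\<close>
    have F1: "card (block_factors N (w (Suc m) c)) \<le> r * (H + 2 * N)" if "valid (Suc m) c" for c
      unfolding r_def by (rule card_factors_w_Suc[OF N F0 that])
    have F2: "card (block_factors N (w (Suc (Suc m)) c)) \<le> r * (r * (H + 2 * N) + 2 * N)"
      if "valid (Suc (Suc m)) c" for c
      unfolding r_def by (rule card_factors_w_Suc[OF N F1[unfolded r_def] that])
    let ?F = "r * (r * (H + 2 * N) + 2 * N)"
    let ?V = "Collect (valid (Suc (Suc m)))"
    let ?W = "\<lambda>(c, c'). block_factors N (w (Suc (Suc m)) c @ w (Suc (Suc m)) c')"
    have "complexity Y N \<le> card (\<Union>p \<in> ?V \<times> ?V. ?W p)"
      unfolding complexity_def
    proof (rule card_mono)
      show "finite (\<Union>p \<in> ?V \<times> ?V. ?W p)" using card_valid by auto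
      show "words Y N \<subseteq> (\<Union>p \<in> ?V \<times> ?V. ?W p)"
        using words_subset[of "Suc (Suc m)" N] tall by (auto simp: tall_def)
    qed
    also have "\<dots> \<le> (\<Sum>p\<in>?V \<times> ?V. card (?W p))"
      using card_valid by (intro card_UN_le) auto
    also have "\<dots> \<le> (\<Sum>p\<in>?V \<times> ?V. 2 * ?F + N)"
    proof (rule sum_mono)
      fix p assume "p \<in> ?V \<times> ?V"
      then obtain c c' where p: "p = (c, c')" "valid (Suc (Suc m)) c" "valid (Suc (Suc m)) c'" by auto
      show "card (?W p) \<le> 2 * ?F + N"
        using card_block_factors_append[of N "w (Suc (Suc m)) c" "w (Suc (Suc m)) c'"] F2[OF p(2)] F2[OF p(3)]
        unfolding p(1) prod.case by linarith
    qed
    also have "\<dots> = card ?V * card ?V * (2 * ?F + N)" by (simp add: card_cartesian_product)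
    also have "\<dots> \<le> (3 * (D + 1)) * (3 * (D + 1)) * (2 * ?F + N)"
      using card_valid(2)[of "Suc (Suc m)"] by (intro mult_mono) auto
    also have "\<dots> \<le> (3 * (D + 1)) * (3 * (D + 1)) * ((2 * (r * (r * (H + 2) + 2)) + 1) * N)"
    proof (rule mult_left_mono)
      have "H + 2 * N \<le> (H + 2) * N" using N by (simp add: add_mult_distrib)
      then have "r * (H + 2 * N) \<le> r * ((H + 2) * N)" by (rule mult_left_mono) simp
      then have "r * (H + 2 * N) + 2 * N \<le> r * ((H + 2) * N) + 2 * N" by (rule add_right_mono)
      also have "\<dots> = (r * (H + 2) + 2) * N" by (simp add: algebra_simps)
      finally have "?F \<le> r * ((r * (H + 2) + 2) * N)" by (rule mult_left_mono) simp
      then have "2 * ?F + N \<le> 2 * (r * ((r * (H + 2) + 2) * N)) + N" by linarith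
      also have "\<dots> = (2 * (r * (r * (H + 2) + 2)) + 1) * N" by (simp add: algebra_simps)
      finally show "2 * ?F + N \<le> (2 * (r * (r * (H + 2) + 2)) + 1) * N" .
    qed simp
    also have "\<dots> = B * N" unfolding B_def by (simp only: mult.assoc)
    finally show ?thesis .
  qed
  then show ?thesis using that by blast
qed

lemma limsup_complexity: "limsup (\<lambda>n. ereal (real (complexity Y n) / real n)) < \<infinity>"
proof -
  obtain B where B: "\<And>N. complexity Y N \<le> B * N \<or> N = 0" using complexity_bound by blast
  have "ereal (real (complexity Y n) / real n) \<le> ereal (real B)" for n
  proof (cases "n = 0")
    case False
    then have "real (complexity Y n) \<le> real B * real n"
      using B[of n] by (metis of_nat_le_iff of_nat_mult)
    then show ?thesis using False by (simp add: divide_le_eq)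
  qed simp
  then have "limsup (\<lambda>n. ereal (real (complexity Y n) / real n)) \<le> ereal (real B)"
    by (intro Limsup_bounded) simp
  then show ?thesis by (rule order.strict_trans1) simp
qed

end

section \<open>Kakutani-Rohlin partitions and telescoping\<close>

lemma cantor_set_compact:
  assumes "cantor_set X" shows "compact_space X"
proof -
  have "compact_space (product_topology (\<lambda>_::nat. discrete_topology (UNIV::bool set)) UNIV)"
    by (simp add: compact_space_product_topology compact_space_discrete_topology)
  then show ?thesis using assms homeomorphic_compact_space unfolding cantor_set_def by blast
qed

lemma cantor_set_Hausdorff:
  assumes "cantor_set X" shows "Hausdorff_space X"
proof -
  have "Hausdorff_space (product_topology (\<lambda>_::nat. discrete_topology (UNIV::bool set)) UNIV)"
    by (simp add: Hausdorff_space_product_topology)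
  then show ?thesis using assms homeomorphic_Hausdorff_space unfolding cantor_set_def by blast
qed

lemma cantor_set_infinite:
  assumes "cantor_set X" shows "infinite (topspace X)"
proof
  assume fin: "finite (topspace X)"
  obtain f where "homeomorphic_map X (product_topology (\<lambda>_::nat. discrete_topology (UNIV::bool set)) UNIV) f"
    using assms unfolding cantor_set_def homeomorphic_space by blast
  then have "f ` topspace X = UNIV"
    using homeomorphic_imp_surjective_map by fastforce
  then have "finite (UNIV :: (nat \<Rightarrow> bool) set)" using fin by (metis finite_imageI)
  then show False by (simp add: finite_UNIV_fun)
qed

locale nested_system =
  fixes X :: "'a topology" and T :: "'a \<Rightarrow> 'a" and d :: "nat \<Rightarrow> nat"
    and B :: "nat \<Rightarrow> nat \<Rightarrow> 'a set" and h :: "nat \<Rightarrow> nat \<Rightarrow> nat"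
  assumes minimal: "minimal_cantor_system X T"
    and nested: "nested_ckr X T d B h" and primitive: "primitive_ckr X T d B h"

sublocale nested_system \<subseteq> bijective_system X T
proof
  have "homeomorphic_map X X T" using minimal by (simp add: minimal_cantor_system_def)
  then show "bij_betw T (topspace X) (topspace X)"
    by (metis bij_betw_def homeomorphic_imp_surjective_map homeomorphic_map_def)
qed

context nested_system
begin

lemma compact: "compact_space X" and hausdorff: "Hausdorff_space X" and homeo: "homeomorphic_map X X T"
  using minimal cantor_set_compact cantor_set_Hausdorff by (auto simp: minimal_cantor_system_def)

lemma ckr: "ckr_partition X T (d n) (B n) (h n)"
  using nested by (simp add: nested_ckr_def)

lemma B_clopen: "k \<in> {1..d n} \<Longrightarrow> openin X (B n k) \<and> closedin X (B n k) \<and> 1 \<le> h n k"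
  using ckr[of n] unfolding ckr_partition_def by blast

section \<open>Coordinates of a point in a Kakutani-Rohlin partition\<close>

definition located :: "nat \<Rightarrow> 'a \<Rightarrow> nat \<Rightarrow> nat \<Rightarrow> bool" where
  "located n x k j \<longleftrightarrow> k \<in> {1..d n} \<and> j < h n k \<and> x \<in> preim X T j (B n k)"

lemma located_unique:
  assumes "located n x k j" "located n x k' j'" shows "k = k'" "j = j'"
proof -
  have disj: "disjoint_family_on (\<lambda>(k, j). preim X T j (B n k)) (SIGMA k:{1..d n}. {..<h n k})"
    using ckr[of n] by (simp add: ckr_partition_def)
  have "(k, j) = (k', j')"
  proof (rule ccontr)
    assume "(k, j) \<noteq> (k', j')"
    moreover have "(k, j) \<in> (SIGMA k:{1..d n}. {..<h n k})" "(k', j') \<in> (SIGMA k:{1..d n}. {..<h n k})"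
      using assms by (auto simp: located_def)
    ultimately have "preim X T j (B n k) \<inter> preim X T j' (B n k') = {}"
      using disj unfolding disjoint_family_on_def by fastforce
    then show False using assms by (auto simp: located_def)
  qed
  then show "k = k'" "j = j'" by auto
qed

lemma located_exists: "x \<in> topspace X \<Longrightarrow> \<exists>k j. located n x k j"
proof -
  assume x: "x \<in> topspace X"
  have "\<Union> (ckr_atoms X T (d n) (B n) (h n)) = topspace X"
    using ckr[of n] by (simp add: ckr_partition_def partition_on_def)
  then obtain A where "A \<in> ckr_atoms X T (d n) (B n) (h n)" "x \<in> A" using x by blast
  then show ?thesis by (auto simp: ckr_atoms_def located_def)
qed

definition K :: "nat \<Rightarrow> 'a \<Rightarrow> nat" where "K n x = (SOME k. \<exists>j. located n x k j)"

definition J :: "nat \<Rightarrow> 'a \<Rightarrow> nat" where "J n x = (SOME j. located n x (K n x) j)"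

text \<open>\<open>J\<close> is the time left until the base, which is how the partition indexes its
  floors; \<open>P\<close> counts upwards from the lowest floor, as \<open>tower_system\<close>
  does.\<close>

definition P :: "nat \<Rightarrow> 'a \<Rightarrow> nat" where "P n x = h n (K n x) - 1 - J n x"

lemma located_KJ: "x \<in> topspace X \<Longrightarrow> located n x (K n x) (J n x)"
  unfolding K_def J_def using located_exists[of x n] by (metis (mono_tags, lifting) someI_ex)

lemma located_iff: "located n x k j \<longleftrightarrow> x \<in> topspace X \<and> K n x = k \<and> J n x = j"
proof
  assume l: "located n x k j"
  then have "x \<in> topspace X" by (simp add: located_def preim_def)
  then show "x \<in> topspace X \<and> K n x = k \<and> J n x = j"
    using located_unique[OF located_KJ[of x n] l] by simp
qed (use located_KJ in auto)

lemma K_range: "x \<in> topspace X \<Longrightarrow> K n x \<in> {1..d n}"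
  and J_less: "x \<in> topspace X \<Longrightarrow> J n x < h n (K n x)"
  using located_KJ[of x n] by (auto simp: located_def)

lemma J_P: "x \<in> topspace X \<Longrightarrow> J n x + P n x + 1 = h n (K n x)"
  using J_less[of x n] by (simp add: P_def)

lemma attained:
  assumes "k \<in> {1..d n}" "j < h n k"
  obtains x where "x \<in> topspace X" "K n x = k" "J n x = j"
proof -
  have "{} \<notin> ckr_atoms X T (d n) (B n) (h n)"
    using ckr[of n] by (simp add: ckr_partition_def partition_on_def)
  moreover have "preim X T j (B n k) \<in> ckr_atoms X T (d n) (B n) (h n)"
    using assms unfolding ckr_atoms_def by blast
  ultimately obtain x where "x \<in> preim X T j (B n k)" by (metis ex_in_conv)
  then have "located n x k j" using assms by (simp add: located_def)
  then show ?thesis using that[of x] by (simp add: located_iff)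
qed

lemma J_descend:
  assumes x: "x \<in> topspace X" and "0 < J n x"
  shows "K n (T x) = K n x \<and> J n (T x) + 1 = J n x"
proof -
  obtain j where j: "J n x = Suc j" using assms(2) by (cases "J n x") auto
  have "located n x (K n x) (Suc j)" using located_KJ[OF x, of n] j by simp
  then have "located n (T x) (K n x) j"
    using T_in[OF x] by (auto simp: located_def preim_def funpow_swap1)
  then show ?thesis using j by (simp add: located_iff)
qed

text \<open>A point of the base lies in some \<open>T^{-h(k)} B(k)\<close>, by the last condition on
  a partition, and one step of \<open>T\<close> takes it to a lowest floor.\<close>

lemma J_base:
  assumes x: "x \<in> topspace X" and "J n x = 0" shows "P n (T x) = 0"
proof -
  have "located n x (K n x) 0" using located_KJ[OF x, of n] assms(2) by simp
  then have "x \<in> ckr_base (d n) (B n)" by (auto simp: located_def preim_def ckr_base_def)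
  moreover have "(\<Union>k\<in>{1..d n}. preim X T (h n k) (B n k)) = ckr_base (d n) (B n)"
    using ckr[of n] by (simp add: ckr_partition_def)
  ultimately obtain k where k: "k \<in> {1..d n}" "x \<in> preim X T (h n k) (B n k)" by blast
  have "h n k = Suc (h n k - 1)" using B_clopen[OF k(1)] by simp
  then have "T x \<in> preim X T (h n k - 1) (B n k)"
    using k(2) T_in[OF x] by (metis (mono_tags, lifting) comp_apply funpow_Suc_right mem_Collect_eq preim_def)
  then have "located n (T x) k (h n k - 1)" using k B_clopen[OF k(1)] by (simp add: located_def)
  then show ?thesis by (simp add: located_iff P_def)
qed

lemma P_0_preimage:
  assumes x: "x \<in> topspace X" and "P n x = 0"
  obtains y where "y \<in> topspace X" "x = T y" "J n y = 0"
proof -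
  obtain y where y: "y \<in> topspace X" "x = T y" using T_surj x by blast
  have "J n y = 0"
  proof (rule ccontr)
    assume "J n y \<noteq> 0"
    then have "K n x = K n y" "J n x + 1 = J n y" using J_descend[OF y(1), of n] y(2) by auto
    then show False using J_P[OF x, of n] J_less[OF y(1), of n] assms(2) by simp
  qed
  then show ?thesis using that y by blast
qed

lemma refine_Suc:
  assumes x: "x \<in> topspace X" and y: "y \<in> topspace X" and "K (Suc n) x = K (Suc n) y" "J (Suc n) x = J (Suc n) y"
  shows "K n x = K n y \<and> J n x = J n y"
proof -
  let ?A = "preim X T (J (Suc n) x) (B (Suc n) (K (Suc n) x))"
  have l: "located (Suc n) x (K (Suc n) x) (J (Suc n) x)" "located (Suc n) y (K (Suc n) x) (J (Suc n) x)"
    using located_KJ[OF x, of "Suc n"] located_KJ[OF y, of "Suc n"] assms by simp_all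
  then have "?A \<in> ckr_atoms X T (d (Suc n)) (B (Suc n)) (h (Suc n))"
    unfolding ckr_atoms_def located_def by blast
  moreover have "refines (topspace X) (ckr_atoms X T (d (Suc n)) (B (Suc n)) (h (Suc n)))
      (ckr_atoms X T (d n) (B n) (h n))"
    using nested by (simp add: nested_ckr_def)
  ultimately obtain A where "A \<in> ckr_atoms X T (d n) (B n) (h n)" "?A \<subseteq> A"
    unfolding refines_def by blast
  then obtain k j where "k \<in> {1..d n}" "j < h n k" "?A \<subseteq> preim X T j (B n k)" by (auto simp: ckr_atoms_def)
  then have "located n x k j" "located n y k j" using l by (auto simp: located_def)
  then show ?thesis by (simp add: located_iff)
qed

lemma refine:
  assumes x: "x \<in> topspace X" and y: "y \<in> topspace X" and "n \<le> m" "K m x = K m y" "J m x = J m y"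
  shows "K n x = K n y \<and> J n x = J n y"
  using assms(3)
proof (induction rule: inc_induct)
  case (step i)
  then show ?case using refine_Suc[OF x y, of i] by simp
qed (use assms in simp)

lemma base_iff: "x \<in> ckr_base (d n) (B n) \<longleftrightarrow> x \<in> topspace X \<and> J n x = 0"
proof
  assume "x \<in> ckr_base (d n) (B n)"
  then obtain k where k: "k \<in> {1..d n}" "x \<in> B n k" by (auto simp: ckr_base_def)
  then have "x \<in> topspace X" using B_clopen[OF k(1)] openin_subset by blast
  then have "located n x k 0" using k B_clopen[OF k(1)] by (simp add: located_def preim_def)
  then show "x \<in> topspace X \<and> J n x = 0" by (simp add: located_iff)
next
  assume "x \<in> topspace X \<and> J n x = 0"
  then have "located n x (K n x) 0" using located_KJ[of x n] by simp
  then show "x \<in> ckr_base (d n) (B n)" by (auto simp: located_def preim_def ckr_base_def)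
qed

lemma J_nested_Suc: "x \<in> topspace X \<Longrightarrow> J (Suc n) x = 0 \<Longrightarrow> J n x = 0"
  using nested base_iff[of x n] base_iff[of x "Suc n"] unfolding nested_ckr_def by blast

lemma J_nested:
  assumes x: "x \<in> topspace X" and "n \<le> m" "J m x = 0" shows "J n x = 0"
  using assms(2)
proof (induction rule: inc_induct)
  case (step i)
  then show ?case using J_nested_Suc[OF x] by blast
qed (use assms in simp)

lemma open_atom: "openin X {y \<in> topspace X. K n y = k \<and> J n y = j}"
proof (cases "k \<in> {1..d n} \<and> j < h n k")
  case True
  then have "{y \<in> topspace X. K n y = k \<and> J n y = j} = {y \<in> topspace X. int_iter X T (int j) y \<in> B n k}"
    using located_iff[of n _ k j] unfolding located_def preim_def int_iter_nat by blast
  then show ?thesis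
    using openin_continuous_map_preimage[OF continuous_int_iter[OF homeo]] B_clopen True by metis
next
  case False
  then have "{y \<in> topspace X. K n y = k \<and> J n y = j} = {}"
    using located_KJ[of _ n] by (auto simp: located_def)
  then show ?thesis by (metis openin_empty)
qed

text \<open>The atoms are only known to generate the topology. For intersections one passes to the
  larger of two levels, whose atoms refine those of both.\<close>

lemma basis:
  assumes "openin X U" "x \<in> U"
  shows "\<exists>n. \<forall>y\<in>topspace X. K n y = K n x \<and> J n y = J n x \<longrightarrow> y \<in> U"
proof -
  have "topology_generated_by (\<Union>n. ckr_atoms X T (d n) (B n) (h n)) = X"
    using nested by (simp add: nested_ckr_def)
  then have "generate_topology_on (\<Union>n. ckr_atoms X T (d n) (B n) (h n)) U"
    using assms(1) openin_topology_generated_by by metis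
  then have "\<forall>x\<in>U \<inter> topspace X. \<exists>n. \<forall>y\<in>topspace X. K n y = K n x \<and> J n y = J n x \<longrightarrow> y \<in> U"
  proof (induction rule: generate_topology_on.induct)
    case (Int a b)
    show ?case
    proof
      fix x assume x: "x \<in> (a \<inter> b) \<inter> topspace X"
      obtain n where n: "\<forall>y\<in>topspace X. K n y = K n x \<and> J n y = J n x \<longrightarrow> y \<in> a"
        using Int.IH(1) x by blast
      obtain m where m: "\<forall>y\<in>topspace X. K m y = K m x \<and> J m y = J m x \<longrightarrow> y \<in> b"
        using Int.IH(2) x by blast
      have "y \<in> a \<inter> b" if y: "y \<in> topspace X" "K (max n m) y = K (max n m) x" "J (max n m) y = J (max n m) x" for y
        using refine[OF y(1) _ max.cobounded1 y(2,3)] refine[OF y(1) _ max.cobounded2 y(2,3)] x n m y(1) by blast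
      then show "\<exists>n. \<forall>y\<in>topspace X. K n y = K n x \<and> J n y = J n x \<longrightarrow> y \<in> a \<inter> b" by blast
    qed
  next
    case (UN \<U>)
    show ?case
    proof
      fix x assume "x \<in> \<Union> \<U> \<inter> topspace X"
      then obtain u where u: "u \<in> \<U>" "x \<in> u \<inter> topspace X" by blast
      then obtain n where "\<forall>y\<in>topspace X. K n y = K n x \<and> J n y = J n x \<longrightarrow> y \<in> u"
        using UN.IH by blast
      then show "\<exists>n. \<forall>y\<in>topspace X. K n y = K n x \<and> J n y = J n x \<longrightarrow> y \<in> \<Union> \<U>"
        using u(1) by blast
    qed
  next
    case (Basis s)
    then obtain n k j where s: "k \<in> {1..d n}" "j < h n k" "s = preim X T j (B n k)"
      by (auto simp: ckr_atoms_def)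
    then have "y \<in> s \<longleftrightarrow> y \<in> topspace X \<and> K n y = k \<and> J n y = j" for y
      using located_iff[of n y k j] by (simp add: located_def)
    then show ?case by (intro ballI exI[of _ n]) auto
  qed simp
  then show ?thesis using assms openin_subset by blast
qed

section \<open>The common point of the bases, and growth of the heights\<close>

definition x0 :: 'a where "x0 = (THE x. x \<in> topspace X \<and> (\<forall>n. J n x = 0))"

lemma x0_ex1: "\<exists>!x. x \<in> topspace X \<and> (\<forall>n. J n x = 0)"
proof -
  have "\<exists>x. (\<Inter>n. ckr_base (d n) (B n)) = {x}" using nested by (simp only: nested_ckr_def)
  then obtain x where "(\<Inter>n. ckr_base (d n) (B n)) = {x}" ..
  moreover have "y \<in> (\<Inter>n. ckr_base (d n) (B n)) \<longleftrightarrow> y \<in> topspace X \<and> (\<forall>n. J n y = 0)" for y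
    using base_iff by auto
  ultimately show ?thesis by (metis singleton_iff)
qed

lemma x0: "x0 \<in> topspace X" "J n x0 = 0"
  using theI'[OF x0_ex1] unfolding x0_def by auto

lemma x0_unique: "x \<in> topspace X \<Longrightarrow> (\<And>n. J n x = 0) \<Longrightarrow> x = x0"
  using x0_ex1 x0 by (metis (no_types))

lemma closed_base: "closedin X (ckr_base (d n) (B n))"
  unfolding ckr_base_def by (rule closedin_Union) (use B_clopen in auto)

text \<open>The bases are closed and decrease to the single point \<open>x0\<close>, so compactness
  puts them inside any neighbourhood of it. This turns local properties at \<open>x0\<close> into
  properties of all bases of high level.\<close>

lemma small_base:
  assumes "openin X U" "x0 \<in> U"
  obtains N where "\<And>m x. N \<le> m \<Longrightarrow> x \<in> topspace X \<Longrightarrow> J m x = 0 \<Longrightarrow> x \<in> U"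
proof -
  define F where "F = (\<lambda>n. ckr_base (d n) (B n) - U)"
  have "closedin X (F n)" for n using closed_base assms(1) by (simp add: F_def closedin_diff)
  moreover have "decseq F"
    unfolding F_def decseq_Suc_iff using nested by (auto simp: nested_ckr_def)
  moreover have "(\<Inter>n. F n) = {}"
  proof (rule ccontr)
    assume "(\<Inter>n. F n) \<noteq> {}"
    then obtain x where "\<And>n. x \<in> F n" by blast
    then show False using base_iff x0_unique[of x] assms(2) by (auto simp: F_def)
  qed
  ultimately obtain N where N: "F N = {}" using compact_space_imp_nest[OF compact, of F] by blast
  have "x \<in> U" if "N \<le> m" "x \<in> topspace X" "J m x = 0" for m x
    using N J_nested[OF that(2,1,3)] that(2) base_iff by (auto simp: F_def)
  then show ?thesis using that by blast
qed

text \<open>A periodic orbit is finite, hence closed; being dense it would be the whole space, which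
  is infinite.\<close>

lemma aperiodic_x0:
  assumes "0 < j" shows "int_iter X T (int j) x0 \<noteq> x0"
proof
  assume per: "int_iter X T (int j) x0 = x0"
  have mult: "int_iter X T (m * int j) x0 = x0" for m
  proof (induction m rule: int_induct[where k = 0])
    case (step1 i)
    then show ?case using int_iter_add[OF x0(1), of "int j" "i * int j"] per by (simp add: algebra_simps)
  next
    case (step2 i)
    then show ?case using int_iter_add[OF x0(1), of "- int j" "i * int j"] int_iter_uminus[OF x0(1), of x0 "int j"] per
      by (simp add: algebra_simps)
  qed simp
  have "int_iter X T n x0 = int_iter X T (n mod int j) x0" for n
    using int_iter_add[OF x0(1), of "n mod int j" "n div int j * int j"] mult by simp
  moreover have "n mod int j \<in> {0..<int j}" for n using assms by simp
  ultimately have "orbit_of X T x0 \<subseteq> (\<lambda>n. int_iter X T n x0) ` {0..<int j}"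
    unfolding orbit_of_def by blast
  then have fin: "finite (orbit_of X T x0)" by (rule finite_subset) simp
  have "orbit_of X T x0 \<subseteq> topspace X" using x0 by (auto simp: orbit_of_def)
  then have "closedin X (orbit_of X T x0)"
    using fin hausdorff closedin_Hausdorff_finite by blast
  moreover have "X closure_of orbit_of X T x0 = topspace X"
    using minimal x0 by (simp add: minimal_cantor_system_def)
  ultimately have "finite (topspace X)" using fin by (simp add: closure_of_closedin)
  then show False using minimal cantor_set_infinite by (auto simp: minimal_cantor_system_def)
qed

text \<open>A tower of height exactly \<open>M\<close> leads from the base back to the base in
  \<open>M\<close> steps. At high levels the bases lie in a neighbourhood \<open>U\<close> of
  \<open>x0\<close> that is disjoint from its image under the M-th power of \<open>T\<close>,
  because \<open>x0\<close> is not periodic. The induction thus excludes one height at a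
  time.\<close>

lemma heights_grow: "\<exists>N. \<forall>m\<ge>N. \<forall>k\<in>{1..d m}. M \<le> h m k"
proof (induction M)
  case (Suc M)
  then obtain N where N: "\<And>m k. N \<le> m \<Longrightarrow> k \<in> {1..d m} \<Longrightarrow> M \<le> h m k" by blast
  show ?case
  proof (cases "M = 0")
    case True
    then show ?thesis using B_clopen by auto
  next
    case False
    let ?T = "int_iter X T (int M)"
    have "?T x0 \<noteq> x0" "?T x0 \<in> topspace X" using aperiodic_x0 False x0 by auto
    then obtain V W where VW: "openin X V" "openin X W" "x0 \<in> V" "?T x0 \<in> W" "V \<inter> W = {}"
      using hausdorff x0(1) unfolding Hausdorff_space_def disjnt_def by metis
    define U where "U = V \<inter> {x \<in> topspace X. ?T x \<in> W}"
    have "openin X U" unfolding U_def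
      using VW openin_continuous_map_preimage[OF continuous_int_iter[OF homeo]] by blast
    moreover have "x0 \<in> U" using VW x0 by (simp add: U_def)
    ultimately obtain N' where N': "\<And>m x. N' \<le> m \<Longrightarrow> x \<in> topspace X \<Longrightarrow> J m x = 0 \<Longrightarrow> x \<in> U"
      using small_base by blast
    have "Suc M \<le> h m k" if m: "max N N' \<le> m" and k: "k \<in> {1..d m}" for m k
    proof (rule ccontr)
      assume "\<not> Suc M \<le> h m k"
      then have hM: "h m k = M" using N[of m k] m k by simp
      obtain z where z: "z \<in> topspace X" "K m z = k" "J m z = M - 1"
        using attained[OF k, of "M - 1"] hM False by auto
      have Pz: "P m z = 0" using J_P[OF z(1), of m] z hM False by simp
      obtain y where y: "y \<in> topspace X" "z = T y" "J m y = 0" using P_0_preimage[OF z(1) Pz] by metis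
      have "(T ^^ (M - 1)) z \<in> B m k" using located_KJ[OF z(1), of m] z by (simp add: located_def preim_def)
      moreover have "(T ^^ (M - 1)) z = ?T y"
        using funpow_Suc_right[of "M - 1" T] y(2) False by (simp add: int_iter_nat del: funpow.simps)
      ultimately have "?T y \<in> ckr_base (d m) (B m)" using k by (auto simp: ckr_base_def)
      then have "?T y \<in> U" "y \<in> U" using base_iff N' m y by auto
      then show False using VW by (auto simp: U_def)
    qed
    then show ?thesis by blast
  qed
qed simp

lemma reach_base: "x \<in> topspace X \<Longrightarrow> J n (int_iter X T (int (J n x)) x) = 0"
proof (induction "J n x" arbitrary: x)
  case (Suc j)
  then have "J n (T x) = j" using J_descend[OF Suc.prems, of n] by simp
  then have "J n (int_iter X T (int j) (T x)) = 0" using Suc T_in by metis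
  then show ?case using int_iter_add[OF Suc.prems, of "int j" 1] by (simp add: add.commute flip: Suc(2))
qed simp

section \<open>Telescoping to frequent occurrences and a common first block\<close>

definition frequent :: "nat \<Rightarrow> nat \<Rightarrow> nat \<Rightarrow> bool" where
  "frequent M n N \<longleftrightarrow> (\<forall>z\<in>topspace X. P N z = 0 \<longrightarrow> (\<forall>l\<in>{1..d n}. M \<le> card {i. i < h N (K N z) \<and>
     K n (int_iter X T (int i) z) = l \<and> P n (int_iter X T (int i) z) = 0}))"

text \<open>This is left properness of the morphism that writes the towers of level \<open>N\<close>
  as words in the towers of level \<open>n\<close>.\<close>

definition proper :: "nat \<Rightarrow> nat \<Rightarrow> bool" where
  "proper n N \<longleftrightarrow> (\<exists>a. \<forall>x\<in>topspace X. P N x = 0 \<longrightarrow> K n x = a)"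

text \<open>Lowest floors are images under \<open>T\<close> of the base, which shrinks to
  \<open>x0\<close>, and the tower of level n through \<open>T x\<close> is constant for
  \<open>x\<close> near \<open>x0\<close>.\<close>

lemma eventually_proper: obtains N where "\<And>m. N \<le> m \<Longrightarrow> proper n m"
proof -
  define U where "U = {y \<in> topspace X. int_iter X T 1 y \<in> {y \<in> topspace X. K n y = K n (T x0) \<and> J n y = J n (T x0)}}"
  have "openin X U" unfolding U_def
    by (rule openin_continuous_map_preimage[OF continuous_int_iter[OF homeo] open_atom])
  moreover have "x0 \<in> U" using x0 T_in by (simp add: U_def)
  ultimately obtain N where N: "\<And>m x. N \<le> m \<Longrightarrow> x \<in> topspace X \<Longrightarrow> J m x = 0 \<Longrightarrow> x \<in> U"
    using small_base by blast
  have "proper n m" if "N \<le> m" for m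
    unfolding proper_def
  proof (intro exI[of _ "K n (T x0)"] ballI impI)
    fix x assume x: "x \<in> topspace X" "P m x = 0"
    obtain y where "y \<in> topspace X" "x = T y" "J m y = 0" using P_0_preimage[OF x] by metis
    then show "K n x = K n (T x0)" using N[OF that, of y] by (simp add: U_def)
  qed
  then show ?thesis using that by blast
qed

text \<open>Primitivity gives a level \<open>N1\<close> whose towers contain all towers of level n,
  so each of these begins in every orbit piece of length \<open>2 * H\<close>. Towers of height at
  least \<open>M * (2 * H)\<close> contain \<open>M\<close> disjoint pieces.\<close>

lemma eventually_frequent:
  assumes "1 \<le> n" obtains N where "\<And>m. N \<le> m \<Longrightarrow> frequent M n m"
proof -
  obtain N1 where N1: "\<And>k l. k \<in> {1..d N1} \<Longrightarrow> l \<in> {1..d n} \<Longrightarrow> crosses X T (B N1 k) (h N1 k) (B n l) (h n l)"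
    using primitive assms unfolding primitive_ckr_def by blast
  define H where "H = (\<Sum>k\<in>{1..d N1}. h N1 k)"
  have H: "h N1 k \<le> H" if "k \<in> {1..d N1}" for k
    unfolding H_def by (rule member_le_sum) (use that in auto)
  obtain N2 where N2: "\<And>m k. N2 \<le> m \<Longrightarrow> k \<in> {1..d m} \<Longrightarrow> M * (2 * H) \<le> h m k"
    using heights_grow[of "M * (2 * H)"] by blast
  have visit: "\<exists>i < 2 * H. K n (int_iter X T (int i) y) = l \<and> P n (int_iter X T (int i) y) = 0"
    if y: "y \<in> topspace X" and l: "l \<in> {1..d n}" for y l
  proof -
    \<comment> \<open>At most \<open>H\<close> steps lead to the bottom of the next tower of level
      \<open>N1\<close>, and fewer than \<open>H\<close> more to the point where it begins to cross
      \<open>l\<close>.\<close>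
    define s where "s = J N1 y + 1"
    define z where "z = int_iter X T (int s) y"
    have z: "z \<in> topspace X" using y by (simp add: z_def)
    have "int_iter X T (int s) y = T (int_iter X T (int (J N1 y)) y)"
      using int_iter_Suc[OF y, of "int (J N1 y)"] by (simp add: s_def add.commute)
    then have Pz: "P N1 z = 0" using J_base[OF _ reach_base[OF y, of N1]] y by (simp add: z_def)
    have "J N1 z = h N1 (K N1 z) - 1" using J_P[OF z, of N1] Pz by simp
    then have zp: "z \<in> preim X T (h N1 (K N1 z) - 1) (B N1 (K N1 z))"
      using located_KJ[OF z, of N1] by (simp add: located_def)
    obtain i where i: "i + h n l \<le> h N1 (K N1 z)"
      "\<And>j. j < h n l \<Longrightarrow> (T ^^ (i + j)) z \<in> preim X T (h n l - 1 - j) (B n l)"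
      using N1[OF K_range[OF z] l] zp unfolding crosses_def by blast
    have hl: "1 \<le> h n l" using B_clopen[OF l] by simp
    then have "(T ^^ i) z \<in> preim X T (h n l - 1) (B n l)" using i(2)[of 0] by simp
    then have "located n ((T ^^ i) z) l (h n l - 1)" using l hl by (simp add: located_def)
    then have "K n ((T ^^ i) z) = l" "P n ((T ^^ i) z) = 0" by (simp_all add: located_iff P_def)
    moreover have "(T ^^ i) z = int_iter X T (int (i + s)) y"
      using int_iter_add[OF y, of "int i" "int s"] by (simp add: z_def int_iter_nat)
    moreover have "s \<le> H" using J_less[OF y, of N1] H[OF K_range[OF y]] by (simp add: s_def)
    then have "i + s < 2 * H" using i(1) hl H[OF K_range[OF z]] by simp
    ultimately show ?thesis by metis
  qed
  have "frequent M n m" if m: "N2 \<le> m" for m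
    unfolding frequent_def
  proof (intro ballI impI)
    fix z l assume z: "z \<in> topspace X" "P m z = 0" and l: "l \<in> {1..d n}"
    let ?S = "{i. i < h m (K m z) \<and> K n (int_iter X T (int i) z) = l \<and> P n (int_iter X T (int i) z) = 0}"
    have "\<exists>t. r * (2 * H) \<le> t \<and> t < (r + 1) * (2 * H) \<and> K n (int_iter X T (int t) z) = l \<and> P n (int_iter X T (int t) z) = 0"
      for r
    proof -
      obtain i where "i < 2 * H" "K n (int_iter X T (int i) (int_iter X T (int (r * (2 * H))) z)) = l"
        "P n (int_iter X T (int i) (int_iter X T (int (r * (2 * H))) z)) = 0"
        using visit[of "int_iter X T (int (r * (2 * H))) z" l] l z(1) by auto
      then show ?thesis
        using int_iter_add[OF z(1), of "int i" "int (r * (2 * H))"] by (intro exI[of _ "i + r * (2 * H)"]) simp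
    qed
    then obtain t where t: "\<And>r. r * (2 * H) \<le> t r \<and> t r < (r + 1) * (2 * H) \<and>
      K n (int_iter X T (int (t r)) z) = l \<and> P n (int_iter X T (int (t r)) z) = 0" by metis
    have lt: "t r < t r'" if "r < r'" for r r'
    proof -
      have "(r + 1) * (2 * H) \<le> r' * (2 * H)" using that by (intro mult_right_mono) auto
      then show ?thesis using t[of r] t[of r'] by linarith
    qed
    have "inj_on t {..<M}" by (rule inj_onI) (metis lt nat_neq_iff)
    moreover have "t ` {..<M} \<subseteq> ?S"
    proof
      fix i assume "i \<in> t ` {..<M}"
      then obtain r where r: "r < M" "i = t r" by blast
      have "(r + 1) * (2 * H) \<le> M * (2 * H)" using r by (intro mult_right_mono) auto
      then have "i < h m (K m z)" using t[of r] r N2[OF m K_range[OF z(1)]] by linarith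
      then show "i \<in> ?S" using t[of r] r by simp
    qed
    ultimately show "M \<le> card ?S" using card_mono[of ?S "t ` {..<M}"] by (simp add: card_image)
  qed
  then show ?thesis using that by blast
qed

text \<open>Both properties hold at all sufficiently high levels, so a single choice serves both.
  The chosen levels are at least 1 because primitivity is assumed from level 1 on.\<close>

lemma telescoping:
  obtains \<nu> :: "nat \<Rightarrow> nat" where "\<And>n. \<nu> n < \<nu> (Suc n)"
    "\<And>n. proper (\<nu> n) (\<nu> (Suc n))" "\<And>n. frequent M (\<nu> n) (\<nu> (Suc n))"
proof -
  have "\<exists>N. 1 \<le> N \<and> n < N \<and> proper n N \<and> frequent M n N" if n: "1 \<le> n" for n
  proof -
    obtain N1 where N1: "\<And>m. N1 \<le> m \<Longrightarrow> proper n m" using eventually_proper by blast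
    obtain N2 where N2: "\<And>m. N2 \<le> m \<Longrightarrow> frequent M n m" using eventually_frequent[OF n] by blast
    have "N1 \<le> N1 + N2 + n + 1" "N2 \<le> N1 + N2 + n + 1" "n < N1 + N2 + n + 1" by simp_all
    then show ?thesis using N1 N2 n by (intro exI[of _ "N1 + N2 + n + 1"]) auto
  qed
  then have "\<exists>f. \<forall>n. 1 \<le> f n \<and> f n < f (Suc n) \<and> proper (f n) (f (Suc n)) \<and> frequent M (f n) (f (Suc n))"
    using dependent_nat_choice[of "\<lambda>_ n. 1 \<le> n" "\<lambda>_ n N. n < N \<and> proper n N \<and> frequent M n N"] by force
  then show ?thesis using that by blast
qed

text \<open>Conditions between consecutive levels pass to the subsequence by transitivity. Those
  that involve all levels, the basis and the uniqueness of \<open>x0\<close>, survive because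
  \<open>n \<le> \<nu> n\<close> and a finer level determines a coarser one.\<close>

lemma tower_system:
  assumes "\<And>n. d n \<le> D"
  obtains K' P' h' a where "tower_system X T K' P' h' a D x0"
proof -
  obtain \<nu> where \<nu>: "\<And>n. \<nu> n < \<nu> (Suc n)" "\<And>n. proper (\<nu> n) (\<nu> (Suc n))" "\<And>n. frequent (3 * D + 10) (\<nu> n) (\<nu> (Suc n))"
    using telescoping[of "3 * D + 10"] by blast
  have mono: "strict_mono \<nu>" using \<nu>(1) by (simp add: strict_mono_Suc_iff)
  obtain a where a: "\<And>n x. x \<in> topspace X \<Longrightarrow> P (\<nu> (Suc n)) x = 0 \<Longrightarrow> K (\<nu> n) x = a n"
    using \<nu>(2) unfolding proper_def by metis
  have le: "\<nu> n \<le> \<nu> (Suc n)" for n using \<nu>(1)[of n] by simp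
  have top: "P n x + 1 = h n (K n x) \<longleftrightarrow> J n x = 0" if "x \<in> topspace X" for n x
    using J_P[OF that, of n] by linarith
  have Peq: "P n y = P n x \<longleftrightarrow> J n y = J n x" if "x \<in> topspace X" "y \<in> topspace X" "K n y = K n x" for n x y
    using J_P[OF that(1), of n] J_P[OF that(2), of n] unfolding that(3) by linarith
  have "tower_system X T (\<lambda>n. K (\<nu> n)) (\<lambda>n. P (\<nu> n)) (\<lambda>n. h (\<nu> n)) a D x0"
  proof
    show "K (\<nu> n) x \<le> D" if "x \<in> topspace X" for x n
      using K_range[OF that, of "\<nu> n"] assms[of "\<nu> n"] by simp
    show "P (\<nu> n) x < h (\<nu> n) (K (\<nu> n) x)" if "x \<in> topspace X" for x n
      using J_P[OF that, of "\<nu> n"] by linarith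
    show "K (\<nu> n) (T x) = K (\<nu> n) x \<and> P (\<nu> n) (T x) = P (\<nu> n) x + 1"
      if x: "x \<in> topspace X" and "P (\<nu> n) x + 1 < h (\<nu> n) (K (\<nu> n) x)" for x n
    proof -
      have "0 < J (\<nu> n) x" using that J_P[OF x, of "\<nu> n"] by linarith
      then show ?thesis
        using J_descend[OF x, of "\<nu> n"] J_P[OF x, of "\<nu> n"] J_P[OF T_in[OF x], of "\<nu> n"] by simp
    qed
    show "P (\<nu> n) (T x) = 0" if "x \<in> topspace X" "P (\<nu> n) x + 1 = h (\<nu> n) (K (\<nu> n) x)" for x n
      using that(2) top[OF that(1), of "\<nu> n"] J_base[OF that(1), of "\<nu> n"] by simp
    show "K (\<nu> n) x = K (\<nu> n) y \<and> P (\<nu> n) x = P (\<nu> n) y"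
      if "x \<in> topspace X" "y \<in> topspace X" "K (\<nu> (Suc n)) x = K (\<nu> (Suc n)) y" "P (\<nu> (Suc n)) x = P (\<nu> (Suc n)) y" for x y n
      using refine[OF that(1,2) le[of n]] that Peq by metis
    show "P (\<nu> n) x + 1 = h (\<nu> n) (K (\<nu> n) x)"
      if "x \<in> topspace X" "P (\<nu> (Suc n)) x + 1 = h (\<nu> (Suc n)) (K (\<nu> (Suc n)) x)" for x n
      using that(2) top[OF that(1), of "\<nu> (Suc n)"] top[OF that(1), of "\<nu> n"] J_nested[OF that(1) le[of n]]
      by simp
    show "P (\<nu> n) x = 0 \<and> K (\<nu> n) x = a n" if x: "x \<in> topspace X" "P (\<nu> (Suc n)) x = 0" for x n
    proof -
      obtain y where y: "y \<in> topspace X" "x = T y" "J (\<nu> (Suc n)) y = 0" using P_0_preimage[OF x] by blast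
      have "J (\<nu> n) y = 0" by (rule J_nested[OF y(1) le y(3)])
      then show ?thesis using J_base[OF y(1), of "\<nu> n"] a[OF x] y(2) by simp
    qed
    show "openin X {y \<in> topspace X. K (\<nu> n) y = k \<and> P (\<nu> n) y = p}" for n k p
    proof (cases "p < h (\<nu> n) k")
      case True
      have "P (\<nu> n) y = p \<longleftrightarrow> J (\<nu> n) y = h (\<nu> n) k - 1 - p" if "y \<in> topspace X" "K (\<nu> n) y = k" for y
        using J_P[OF that(1), of "\<nu> n"] True unfolding that(2) by linarith
      then have "{y \<in> topspace X. K (\<nu> n) y = k \<and> P (\<nu> n) y = p} =
          {y \<in> topspace X. K (\<nu> n) y = k \<and> J (\<nu> n) y = h (\<nu> n) k - 1 - p}" by blast
      then show ?thesis by (simp only: open_atom)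
    next
      case False
      have "P (\<nu> n) y < h (\<nu> n) (K (\<nu> n) y)" if "y \<in> topspace X" for y
        using J_P[OF that, of "\<nu> n"] by linarith
      then have "{y \<in> topspace X. K (\<nu> n) y = k \<and> P (\<nu> n) y = p} = {}" using False by auto
      then show ?thesis by (simp only: openin_empty)
    qed
    show "\<exists>n. \<forall>y\<in>topspace X. K (\<nu> n) y = K (\<nu> n) x \<and> P (\<nu> n) y = P (\<nu> n) x \<longrightarrow> y \<in> U"
      if U: "openin X U" "x \<in> U" for U x
    proof -
      have x: "x \<in> topspace X" using U openin_subset by blast
      obtain n where n: "\<forall>y\<in>topspace X. K n y = K n x \<and> J n y = J n x \<longrightarrow> y \<in> U"
        using basis[OF U] by blast
      have "n \<le> \<nu> n" using strict_mono_imp_increasing[OF mono] .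
      then have "y \<in> U" if "y \<in> topspace X" "K (\<nu> n) y = K (\<nu> n) x" "P (\<nu> n) y = P (\<nu> n) x" for y
        using refine[OF that(1) x, of n "\<nu> n"] Peq[OF x that(1), of "\<nu> n"] that n by simp
      then show ?thesis by blast
    qed
    show "x0 \<in> topspace X" by (rule x0)
    show "P (\<nu> n) x0 + 1 = h (\<nu> n) (K (\<nu> n) x0)" for n
      using x0(2)[of "\<nu> n"] top[OF x0(1), of "\<nu> n"] by simp
    show "x = x0" if x: "x \<in> topspace X" "\<And>n. P (\<nu> n) x + 1 = h (\<nu> n) (K (\<nu> n) x)" for x
    proof (rule x0_unique[OF x(1)])
      fix n
      have "n \<le> \<nu> n" using strict_mono_imp_increasing[OF mono] .
      moreover have "J (\<nu> n) x = 0" using top[OF x(1), of "\<nu> n"] x(2) by simp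
      ultimately show "J n x = 0" using J_nested[OF x(1)] by simp
    qed
    show "3 * D + 10 \<le> card {i. i < h (\<nu> (Suc n)) (K (\<nu> (Suc n)) x) \<and>
        K (\<nu> n) (int_iter X T (int i) x) = K (\<nu> n) y \<and> P (\<nu> n) (int_iter X T (int i) x) = 0}"
      if "x \<in> topspace X" "y \<in> topspace X" "P (\<nu> (Suc n)) x = 0" for x y n
      using \<nu>(3)[of n] K_range[OF that(2), of "\<nu> n"] that unfolding frequent_def by blast
  qed (rule homeo compact hausdorff)+
  then show ?thesis using that by blast
qed

end

theorem corollary6p14:
  fixes X :: "'a topology" and T :: "'a \<Rightarrow> 'a"
  assumes "minimal_cantor_system X T"
    and "finite_topological_rank X T"
  shows "\<exists>(A :: nat set) (Y :: (int \<Rightarrow> nat) set).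
           is_subshift A Y \<and>
           minimal_cantor_system (subtopology (full_shift A) Y) shift \<and>
           strongly_orbit_equivalent X T (subtopology (full_shift A) Y) shift \<and>
           limsup (\<lambda>n. ereal (real (complexity Y n) / real n)) < \<infinity>"
proof -
  obtain d B h D where dBh: "nested_ckr X T d B h" "primitive_ckr X T d B h" "\<And>n. d n \<le> D"
    using assms(2) unfolding finite_topological_rank_def by blast
  interpret N: nested_system X T d B h
    by standard (use assms(1) dBh in auto)
  obtain K P h' a where "tower_system X T K P h' a D N.x0"
    using N.tower_system[OF dBh(3)] .
  then interpret tower_system X T K P h' a D N.x0 .
  show ?thesis
    using subshift_Y minimal_Y[OF assms(1)] strongly_orbit_equivalent_Y limsup_complexity by blast
qed

end
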